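(* Fix real numbers $\varphi_0<\varphi_1$ and let $\varepsilon_0=1/(\varphi_1-\varphi_0)$. There exists $\varepsilon_2\in(0,\varepsilon_0)$ such that for each $\varepsilon\in(0,\varepsilon_2)$ there exist functions $\rho\in M$ such that $\mathscr F_\varepsilon(\rho)$ is not a singleton.
   Context: $M=\{\rho\in L^\infty([0,1]):0\le\rho\le1\}$. $\mathcal F$ is the set of functions $\varphi:[0,1]\to\mathbb R$ of the form $\varphi(x)=\varphi_0+\mu([0,x])$ with $\mu=d\varphi$ a positive Borel measure on $[0,1]$ of total mass $\varphi_1-\varphi_0$. $s(a)=a\log a+(1-a)\log(1-a)$ for $a\in[0,1]$ (with $0\log0=0$), $s(a)=+\infty$ otherwise. $$\mathcal G_\varepsilon(\rho,\varphi)=\int_0^1\big[s(\rho)+s(\varepsilon\varphi_x)+(1-\rho)\varphi-\log(1+e^\varphi)\big]dx,\qquad(\rho,\varphi)\in M\times\mathcal F,$$ with $\mathcal G_\varepsilon(\rho,\varphi)=+\infty$ unless $d\varphi$ is absolutely continuous with respect to Lebesgue measure with density $\varphi_x$ bounded by $\varepsilon^{-1}$. $\mathscr F_\varepsilon(\rho)\subset\mathcal F$ is the (non-empty) set of minimizers of $\mathcal G_\varepsilon(\rho,\cdot)$ over $\mathcal F$. *)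

theory Defs
  imports "HOL-Analysis.Analysis"
begin

definition unit_lebesgue :: "real measure" where
  "unit_lebesgue = restrict_space lborel {0..1}"

text \<open>Elements of \<open>L\<^sup>\<infinity>([0,1])\<close> are given by Borel representatives; their values outside
  \<open>[0,1]\<close> are irrelevant.\<close>

definition densities :: "(real \<Rightarrow> real) set" where
  "densities = {\<rho> \<in> borel_measurable unit_lebesgue. AE x in unit_lebesgue. 0 \<le> \<rho> x \<and> \<rho> x \<le> 1}"

definition is_increment_measure :: "real \<Rightarrow> real \<Rightarrow> (real \<Rightarrow> real) \<Rightarrow> real measure \<Rightarrow> bool" where
  "is_increment_measure \<phi>0 \<phi>1 \<phi> \<mu> \<longleftrightarrow>
     sets \<mu> = sets (restrict_space borel {0..1}) \<and>
     emeasure \<mu> (space \<mu>) = ennreal (\<phi>1 - \<phi>0) \<and>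
     (\<forall>x\<in>{0..1}. \<phi> x = \<phi>0 + measure \<mu> {0..x})"

text \<open>A function on \<open>[0,1]\<close> is encoded as an element of \<open>extensional {0..1}\<close>, so that two elements
  of the following set are equal iff they agree on \<open>[0,1]\<close>. Atoms of the measure at 0 are allowed:
  \<open>\<phi> 0\<close> need not be \<open>\<phi>0\<close>.\<close>

definition profiles :: "real \<Rightarrow> real \<Rightarrow> (real \<Rightarrow> real) set" where
  "profiles \<phi>0 \<phi>1 = {\<phi> \<in> extensional {0..1}. \<exists>\<mu>. is_increment_measure \<phi>0 \<phi>1 \<phi> \<mu>}"

lemma is_increment_measure_unique:
  assumes "is_increment_measure \<phi>0 \<phi>1 \<phi> \<mu>" and "is_increment_measure \<phi>0 \<phi>1 \<phi> \<nu>"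
  shows "\<mu> = \<nu>"
proof -
  have s: "sets \<mu> = sets (restrict_space borel {0..1})" "sets \<nu> = sets (restrict_space borel {0..1})"
    using assms by (auto simp: is_increment_measure_def)
  have sp: "space \<mu> = {0..1}" "space \<nu> = {0..1}"
    using s[THEN sets_eq_imp_space_eq] by (auto simp: space_restrict_space)
  have tot: "emeasure \<mu> (space \<mu>) = ennreal (\<phi>1 - \<phi>0)" "emeasure \<nu> (space \<nu>) = ennreal (\<phi>1 - \<phi>0)"
    using assms by (auto simp: is_increment_measure_def)
  interpret m: finite_measure \<mu> by standard (simp add: tot)
  interpret n: finite_measure \<nu> by standard (simp add: tot)
  define m' where "m' = distr \<mu> borel (\<lambda>x. x)"
  define n' where "n' = distr \<nu> borel (\<lambda>x. x)"
  have meas: "(\<lambda>x. x) \<in> measurable \<mu> borel" "(\<lambda>x. x) \<in> measurable \<nu> borel"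
    using measurable_ident_sets[OF refl, of "borel::real measure"]
    by (auto simp: measurable_cong_sets[OF s(1) refl] measurable_cong_sets[OF s(2) refl]
        intro!: measurable_restrict_space1)
  have atM: "{..x} \<inter> {0..1} = (if x < 0 then {} else {0..min x 1})" for x :: real by auto
  have eq: "emeasure \<mu> ({..x} \<inter> {0..1}) = emeasure \<nu> ({..x} \<inter> {0..1})" for x
  proof (cases "x < 0")
    case False
    then have "measure \<mu> {0..min x 1} = measure \<nu> {0..min x 1}"
      using assms unfolding is_increment_measure_def by (smt (verit) atLeastAtMost_iff min_def)
    with False show ?thesis by (simp add: atM m.emeasure_eq_measure n.emeasure_eq_measure)
  qed (simp add: atM)
  have fin: "finite_measure m'" "finite_measure n'"
    unfolding m'_def n'_def using meas by (auto intro: m.finite_measure_distr n.finite_measure_distr)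
  have "m' = n'"
  proof (rule measure_eqI_generator_eq[where E="range (\<lambda>x. {..x::real})" and \<Omega>=UNIV and A="\<lambda>i. {..real i}"])
    show "Int_stable (range (\<lambda>x. {..x::real}))" by (auto simp: Int_stable_def)
    show "sets m' = sigma_sets UNIV (range (\<lambda>x. {..x::real}))"
      "sets n' = sigma_sets UNIV (range (\<lambda>x. {..x::real}))"
      by (simp_all add: m'_def n'_def borel_eq_atMost)
    show "emeasure m' X = emeasure n' X" if "X \<in> range (\<lambda>x. {..x::real})" for X
      using that eq by (auto simp: m'_def n'_def emeasure_distr meas sp)
    show "(\<Union>i. {..real i}) = UNIV" by (auto intro: real_arch_simple)
    show "emeasure m' {..real i} \<noteq> \<infinity>" for i
      using finite_measure.emeasure_finite[OF fin(1)] by simp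
  qed auto
  show ?thesis
  proof (rule measure_eqI)
    fix X assume "X \<in> sets \<mu>"
    then have X: "X \<in> sets borel" "X \<subseteq> {0..1}"
      by (auto simp: s sets_restrict_space_iff)
    have "emeasure m' X = emeasure \<mu> X" "emeasure n' X = emeasure \<nu> X"
      using X by (auto simp: m'_def n'_def emeasure_distr meas sp Int_absorb2)
    with \<open>m' = n'\<close> show "emeasure \<mu> X = emeasure \<nu> X" by simp
  qed (simp add: s)
qed

definition increment_measure :: "real \<Rightarrow> real \<Rightarrow> (real \<Rightarrow> real) \<Rightarrow> real measure" where
  "increment_measure \<phi>0 \<phi>1 \<phi> = (THE \<mu>. is_increment_measure \<phi>0 \<phi>1 \<phi> \<mu>)"

lemma increment_measure_eq:
  "is_increment_measure \<phi>0 \<phi>1 \<phi> \<mu> \<Longrightarrow> increment_measure \<phi>0 \<phi>1 \<phi> = \<mu>"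
  unfolding increment_measure_def using is_increment_measure_unique by blast

text \<open>The convention \<open>0 log 0 = 0\<close> holds automatically.\<close>

definition entropy :: "real \<Rightarrow> ereal" where
  "entropy a = (if 0 \<le> a \<and> a \<le> 1 then ereal (a * ln a + (1 - a) * ln (1 - a)) else \<infinity>)"

text \<open>In the finite case, for \<open>\<rho> \<in> densities\<close> and \<open>\<epsilon> > 0\<close>, both entropies are finite almost everywhere
  and the integrand is bounded, so that passing to real values loses nothing.\<close>

definition G_functional ::
  "real \<Rightarrow> real \<Rightarrow> real \<Rightarrow> (real \<Rightarrow> real) \<Rightarrow> (real \<Rightarrow> real) \<Rightarrow> ereal" where
  "G_functional \<phi>0 \<phi>1 \<epsilon> \<rho> \<phi> =
     (let \<mu> = increment_measure \<phi>0 \<phi>1 \<phi>; \<phi>x = RN_deriv unit_lebesgue \<mu> in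
      if absolutely_continuous unit_lebesgue \<mu> \<and> (AE x in unit_lebesgue. \<phi>x x \<le> ennreal (1 / \<epsilon>))
      then ereal (LINT x|unit_lebesgue.
             real_of_ereal (entropy (\<rho> x)) + real_of_ereal (entropy (\<epsilon> * enn2real (\<phi>x x)))
             + (1 - \<rho> x) * \<phi> x - ln (1 + exp (\<phi> x)))
      else \<infinity>)"

definition G_minimizers :: "real \<Rightarrow> real \<Rightarrow> real \<Rightarrow> (real \<Rightarrow> real) \<Rightarrow> (real \<Rightarrow> real) set" where
  "G_minimizers \<phi>0 \<phi>1 \<epsilon> \<rho> =
     {\<phi> \<in> profiles \<phi>0 \<phi>1. \<forall>\<psi> \<in> profiles \<phi>0 \<phi>1.
        G_functional \<phi>0 \<phi>1 \<epsilon> \<rho> \<phi> \<le> G_functional \<phi>0 \<phi>1 \<epsilon> \<rho> \<psi>}"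

end

(* As \<epsilon> tends to 0 the entropy of \<epsilon> \<phi>_x disappears and the remaining integrand is strictly concave in \<phi>, so
   minimizers want to jump between \<phi>0 and \<phi>1. With A x the gain of the value \<phi>1 over \<phi>0 at x, take \<rho> with
   A > 0 on [0,1/2) and A < 0 on [1/2,1]: monotonicity then forces the jump to sit near 0 or near 1, and a
   profile that is halfway at x = 1/2 is worse than both by a margin independent of \<epsilon>. Shifting \<rho> by a
   constant \<tau> moves the balance between the two possibilities, and the infima over the profiles lying above
   resp. below the midpoint at 1/2 are Lipschitz in \<tau>, hence equal for some \<tau>. Both infima are attained:
   Arzela-Ascoli handles the concave term, and the strong convexity of the entropy makes minimizing
   densities Cauchy in L^1. *)
theory Submission
  imports Defs "HOL-Complex_Analysis.Great_Picard" "HOL-Real_Asymp.Real_Asymp"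
begin

text \<open>The energy is not convex in the profile, so two minima are separated by a constraint
  instead. The conditions \<open>\<phi> (1/2)\<close> above or below the midpoint are affine and
  closed, together they cover all profiles, and they overlap only in profiles through the midpoint.
  Once both constrained minima agree, each constrained minimizer is a global one; if the two had
  equal values at 1/2, that value would be the midpoint, which the margin forbids.

  The margin arises pointwise. Let \<eta> be the weight of \<open>\<phi>0\<close> in the convex
  combination that represents the profile. Concavity contributes k \<eta> (1 - \<eta>), which
  reaches k/4 only at \<eta> = 1/2. Away from that value the sign change of A at 1/2, combined with
  the monotonicity of \<eta>, contributes a multiple of |\<eta> - 1/2|. This covers the loss k
  (\<eta> - 1/2)^2 when k is small relative to the step of \<rho>.

  The entropy of \<epsilon> times the slope is only an error term: it is nonpositive, and since the
  mean of its argument is \<epsilon> (\<open>\<phi>1\<close> - \<open>\<phi>0\<close>), its integral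
  is bounded below by a quantity that tends to 0 with \<epsilon>.\<close>

section \<open>Integration over the unit interval\<close>

interpretation unit_lebesgue: finite_measure unit_lebesgue
  by standard (simp add: unit_lebesgue_def space_restrict_space emeasure_restrict_space)

lemma space_unit_lebesgue [simp]: "space unit_lebesgue = {0..1}"
  by (simp add: unit_lebesgue_def space_restrict_space)

lemma measure_unit_lebesgue_space [simp]: "measure unit_lebesgue {0..1} = 1"
  by (simp add: unit_lebesgue_def measure_restrict_space)

lemma sets_unit_lebesgue: "sets unit_lebesgue = sets (restrict_space borel {0..1})"
  unfolding unit_lebesgue_def by (rule sets_restrict_space_cong) simp

lemma measurable_unit_lebesgue:
  "f \<in> borel_measurable borel \<Longrightarrow> f \<in> borel_measurable unit_lebesgue"
  unfolding unit_lebesgue_def by (intro measurable_restrict_space1) simp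

lemma integrable_unit_lebesgue:
  fixes f :: "real \<Rightarrow> real"
  assumes "f \<in> borel_measurable unit_lebesgue" "\<And>x. x \<in> {0..1} \<Longrightarrow> \<bar>f x\<bar> \<le> B"
  shows "integrable unit_lebesgue f"
  using assms by (intro unit_lebesgue.integrable_const_bound[where B=B] AE_I2) auto

lemma integral_unit_lebesgue_mono:
  fixes f g :: "real \<Rightarrow> real"
  assumes "integrable unit_lebesgue f" "integrable unit_lebesgue g"
    "\<And>x. x \<in> {0..1} \<Longrightarrow> f x \<le> g x"
  shows "(LINT x|unit_lebesgue. f x) \<le> (LINT x|unit_lebesgue. g x)"
  using assms by (intro integral_mono) auto

lemma integral_indicator_unit_lebesgue:
  assumes "A \<in> sets borel" "A \<subseteq> {0..1}"
  shows "(LINT x|unit_lebesgue. indicator A x :: real) = measure lborel A"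
proof -
  have "(LINT x|unit_lebesgue. indicator A x :: real) = measure unit_lebesgue A"
    using assms by (simp add: Int_absorb2 Int_commute)
  also have "\<dots> = measure lborel A"
    unfolding unit_lebesgue_def using assms by (intro measure_restrict_space) auto
  finally show ?thesis .
qed

section \<open>Quantitative convexity of softplus and of the binary entropy\<close>

definition softplus :: "real \<Rightarrow> real" where
  "softplus x = ln (1 + exp x)"

definition binary_entropy :: "real \<Rightarrow> real" where
  "binary_entropy x = x * ln x + (1 - x) * ln (1 - x)"

lemma entropy_eq: "0 \<le> x \<Longrightarrow> x \<le> 1 \<Longrightarrow> real_of_ereal (entropy x) = binary_entropy x"
  by (simp add: entropy_def binary_entropy_def)

lemma measurable_binary_entropy [measurable]: "binary_entropy \<in> borel_measurable borel"
  unfolding binary_entropy_def by measurable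

lemma measurable_softplus [measurable]: "softplus \<in> borel_measurable borel"
  unfolding softplus_def by measurable

lemma softplus_deriv: "(softplus has_real_derivative 1 - 1 / (1 + exp x)) (at x)"
proof -
  have "1 + exp x \<noteq> 0" using exp_gt_zero[of x] by linarith
  then show ?thesis
    unfolding softplus_def
    by (auto intro!: derivative_eq_intros simp: field_simps add_pos_pos)
qed

lemma softplus_strict_increasing: "x < y \<Longrightarrow> softplus x < softplus y"
  by (simp add: softplus_def add_pos_pos)

text \<open>Together with monotonicity this puts every secant slope of \<open>softplus\<close>
  strictly between 0 and 1, which later places \<open>balance\<close> inside (0,1).\<close>

lemma softplus_diff_less:
  assumes "x < y" shows "softplus y - softplus x < y - x"
proof -
  have "1 + exp y < exp (y - x) * (1 + exp x)"
    using assms by (simp add: exp_diff field_simps exp_add[symmetric])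
  then have "ln (1 + exp y) < ln (exp (y - x) * (1 + exp x))"
    by (subst ln_less_cancel_iff) (auto intro!: add_pos_pos mult_pos_pos)
  also have "\<dots> = y - x + ln (1 + exp x)"
    by (subst ln_mult) (auto intro: add_pos_pos simp: add_pos_pos[THEN less_imp_neq, THEN not_sym])
  finally show ?thesis by (simp add: softplus_def)
qed

lemma softplus_Lipschitz: "\<bar>softplus x - softplus y\<bar> \<le> \<bar>x - y\<bar>"
proof (cases x y rule: linorder_cases)
  case less
  then show ?thesis using softplus_diff_less[OF less] softplus_strict_increasing[OF less] by simp
next
  case greater
  then show ?thesis using softplus_diff_less[OF greater] softplus_strict_increasing[OF greater] by simp
qed simp

text \<open>Subtracting (m/2) x^2 leaves a convex function when m bounds the second derivative exp x
  / (1 + exp x)^2 from below on [a,b]. The chord defect of this quadratic is exactly (m/2) (b - a)^2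
  t (1 - t), which gives k.\<close>

lemma softplus_strongly_convex:
  assumes "a < b"
  obtains k where "0 < k"
    "\<And>t. 0 \<le> t \<Longrightarrow> t \<le> 1 \<Longrightarrow>
       softplus (t * a + (1 - t) * b) \<le> t * softplus a + (1 - t) * softplus b - k * (t * (1 - t))"
proof
  \<comment> \<open>Smallest numerator over largest denominator of the second derivative on
    [a,b].\<close>
  define m where "m = exp a / (1 + exp b)\<^sup>2"
  have m: "0 < m" unfolding m_def by (intro divide_pos_pos zero_less_power add_pos_pos) auto
  have "convex_on {a..b} (\<lambda>x. softplus x - m / 2 * x\<^sup>2)"
  proof (rule f''_ge0_imp_convex)
    fix x assume x: "x \<in> {a..b}"
    have pos: "1 + exp x \<noteq> 0" using exp_gt_zero[of x] by linarith
    show "((\<lambda>x. softplus x - m / 2 * x\<^sup>2) has_real_derivative (1 - 1 / (1 + exp x)) - m * x) (at x)"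
      by (auto intro!: derivative_eq_intros softplus_deriv)
    show "((\<lambda>x. (1 - 1 / (1 + exp x)) - m * x) has_real_derivative exp x / (1 + exp x)\<^sup>2 - m) (at x)"
      using pos by (auto intro!: derivative_eq_intros simp: power2_eq_square)
    show "0 \<le> exp x / (1 + exp x)\<^sup>2 - m"
      unfolding m_def using x
      by (simp add: add_pos_pos) (intro frac_le power_mono, auto intro: add_pos_pos simp: add_nonneg_nonneg add_pos_pos[THEN less_imp_neq, THEN not_sym])
  qed simp
  note conv = this
  show "0 < m / 2 * (b - a)\<^sup>2" using m assms by simp
  fix t :: real assume t: "0 \<le> t" "t \<le> 1"
  have "softplus (t * a + (1 - t) * b) - m / 2 * (t * a + (1 - t) * b)\<^sup>2
     \<le> t * (softplus a - m / 2 * a\<^sup>2) + (1 - t) * (softplus b - m / 2 * b\<^sup>2)"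
    using convex_onD[OF conv, of "1 - t" a b] t assms by simp
  moreover have "m / 2 * (t * a + (1 - t) * b)\<^sup>2 =
     t * (m / 2 * a\<^sup>2) + (1 - t) * (m / 2 * b\<^sup>2) - m / 2 * (b - a)\<^sup>2 * (t * (1 - t))"
    by (simp add: power2_eq_square field_simps)
  ultimately show "softplus (t * a + (1 - t) * b)
      \<le> t * softplus a + (1 - t) * softplus b - m / 2 * (b - a)\<^sup>2 * (t * (1 - t))"
    by (simp add: algebra_simps)
qed

text \<open>A quantitative Gibbs inequality. Applying ln r \<le> r - 1 to the ratio of the square
  roots p, q of x, m bounds x ln (x/m) - x + m from below by (p - q)^2, and (x - m)^2 = (p + q)^2 (p
  - q)^2 is at most four times that because p + q \<le> 2.\<close>

lemma mult_ln_ge: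
  fixes x m :: real
  assumes "0 \<le> x" "x \<le> 1" "0 < m" "m \<le> 1"
  shows "x * ln m + x - m + (x - m)\<^sup>2 / 4 \<le> x * ln x"
proof (cases "x = 0")
  case True
  have "m * m \<le> m * 1" using assms by (intro mult_left_mono) auto
  then show ?thesis using True assms by (simp add: power2_eq_square)
next
  case False
  define p where "p = sqrt x"
  define q where "q = sqrt m"
  have pq: "0 < p" "p \<le> 1" "0 < q" "q \<le> 1" "x = p\<^sup>2" "m = q\<^sup>2"
    using False assms by (auto simp: p_def q_def)
  have "ln (q / p) \<le> q / p - 1" using pq by (intro ln_le_minus_one) simp
  then have "2 * p\<^sup>2 * ln (q / p) \<le> 2 * p\<^sup>2 * (q / p - 1)"
    by (intro mult_left_mono) auto
  then have 1: "2 * p\<^sup>2 * ln q - 2 * p\<^sup>2 * ln p \<le> 2 * p * q - 2 * p\<^sup>2"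
    using pq by (simp add: ln_div algebra_simps power2_eq_square)
  have 2: "p\<^sup>2 * ln (q\<^sup>2) = 2 * p\<^sup>2 * ln q" "p\<^sup>2 * ln (p\<^sup>2) = 2 * p\<^sup>2 * ln p"
    using pq by (simp_all add: ln_realpow)
  have "(p + q)\<^sup>2 * (p - q)\<^sup>2 \<le> 2\<^sup>2 * (p - q)\<^sup>2"
    using pq by (intro mult_right_mono power_mono) auto
  moreover have "(p\<^sup>2 - q\<^sup>2)\<^sup>2 = (p + q)\<^sup>2 * (p - q)\<^sup>2"
    by (simp add: power2_eq_square algebra_simps)
  ultimately have "(p\<^sup>2 - q\<^sup>2)\<^sup>2 / 4 \<le> (p - q)\<^sup>2" by simp
  then show ?thesis using 1 unfolding pq 2 by (simp add: power2_eq_square algebra_simps)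
qed

text \<open>The affine part on the left is the tangent to the entropy at m. It comes from adding
  \<open>mult_ln_ge\<close> for (x, m) and for (1 - x, 1 - m): the terms x - m cancel, and one of
  the two squares is discarded.\<close>

lemma binary_entropy_ge:
  assumes "0 \<le> x" "x \<le> 1" "0 < m" "m < 1"
  shows "x * ln m + (1 - x) * ln (1 - m) + (x - m)\<^sup>2 / 4 \<le> binary_entropy x"
proof -
  have "x * ln m + x - m + (x - m)\<^sup>2 / 4 \<le> x * ln x"
    using assms by (intro mult_ln_ge) auto
  moreover have "(1 - x) * ln (1 - m) + (1 - x) - (1 - m) + ((1 - x) - (1 - m))\<^sup>2 / 4
      \<le> (1 - x) * ln (1 - x)"
    using assms by (intro mult_ln_ge) auto
  moreover have "0 \<le> ((1 - x) - (1 - m))\<^sup>2 / 4" by simp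
  ultimately show ?thesis unfolding binary_entropy_def by linarith
qed

text \<open>Both points lie at distance |x - y| / 2 from their midpoint, so averaging the two
  tangent estimates there gives the square with factor 1/16. The tangent exists unless the midpoint
  is 0 or 1, and then x = y.\<close>

lemma binary_entropy_midpoint:
  assumes "0 \<le> x" "x \<le> 1" "0 \<le> y" "y \<le> 1"
  shows "binary_entropy ((x + y) / 2) \<le> (binary_entropy x + binary_entropy y) / 2 - (x - y)\<^sup>2 / 16"
proof (cases "0 < x + y \<and> x + y < 2")
  case True
  have e: "x - (x + y) / 2 = (x - y) / 2" "y - (x + y) / 2 = - ((x - y) / 2)"
    by (simp_all add: field_simps)
  define m where "m = (x + y) / 2"
  have xy: "x + y = 2 * m" by (simp add: m_def)
  have "x * ln m + (1 - x) * ln (1 - m) + (x - y)\<^sup>2 / 16 \<le> binary_entropy x"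
    using binary_entropy_ge[of x m] assms True e by (simp add: m_def power_divide)
  moreover have "y * ln m + (1 - y) * ln (1 - m) + (x - y)\<^sup>2 / 16 \<le> binary_entropy y"
    using binary_entropy_ge[of y m] assms True e by (simp add: m_def power_divide)
  moreover have "2 * binary_entropy m
      = (x * ln m + (1 - x) * ln (1 - m)) + (y * ln m + (1 - y) * ln (1 - m))"
  proof -
    have "(x * ln m + (1 - x) * ln (1 - m)) + (y * ln m + (1 - y) * ln (1 - m))
        = (x + y) * ln m + (2 - (x + y)) * ln (1 - m)" by (simp add: algebra_simps)
    then show ?thesis unfolding xy by (simp add: binary_entropy_def algebra_simps)
  qed
  moreover have aux: "p + q \<le> u \<Longrightarrow> p' + q \<le> v \<Longrightarrow> 2 * B = p + p' \<Longrightarrow> B \<le> (u + v) / 2 - q"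
    for p p' q u v B :: real by (simp add: field_simps)
  ultimately have "binary_entropy m \<le> (binary_entropy x + binary_entropy y) / 2 - (x - y)\<^sup>2 / 16"
    using aux by blast
  then show ?thesis by (simp add: m_def)
next
  case False
  then have "x = y" using assms by auto
  then show ?thesis by simp
qed

lemma binary_entropy_nonpos: "0 \<le> x \<Longrightarrow> x \<le> 1 \<Longrightarrow> binary_entropy x \<le> 0"
  unfolding binary_entropy_def
  by (intro add_nonpos_nonpos mult_nonneg_nonpos) (cases "x = 0"; cases "x = 1"; simp)+

text \<open>The tangent at 1/2 is the constant -ln 2, which exceeds -1.\<close>

lemma binary_entropy_ge_minus_one:
  assumes "0 \<le> x" "x \<le> 1" shows "- 1 \<le> binary_entropy x"
proof -
  have "ln (1/2) \<ge> (-1::real)" using ln_2_less_1 by (simp add: ln_div)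
  also have "ln (1/2) = x * ln (1/2) + (1 - x) * ln (1 - 1/2)" by (simp add: algebra_simps)
  also have "\<dots> \<le> \<dots> + (x - 1/2)\<^sup>2 / 4" by simp
  also have "\<dots> \<le> binary_entropy x" using assms by (intro binary_entropy_ge) auto
  finally show ?thesis .
qed

lemma continuous_on_mult_ln: "continuous_on {0..} (\<lambda>x::real. x * ln x)"
  unfolding continuous_on_def
proof
  fix x :: real assume "x \<in> {0..}"
  show "((\<lambda>x. x * ln x) \<longlongrightarrow> x * ln x) (at x within {0..})"
  proof (cases "x = 0")
    case True
    have "((\<lambda>x::real. x * ln x) \<longlongrightarrow> 0) (at_right 0)" by real_asymp
    then show ?thesis using True by (simp add: at_within_Ici_at_right)
  next
    case False
    then show ?thesis by (auto intro!: tendsto_eq_intros)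
  qed
qed

lemma continuous_on_binary_entropy: "continuous_on {0..1} binary_entropy"
  unfolding binary_entropy_def
  by (intro continuous_on_add continuous_on_mult_ln[THEN continuous_on_subset]
       continuous_on_compose2[OF continuous_on_mult_ln, of _ "\<lambda>x. 1 - x"] continuous_intros) auto

section \<open>Profiles, their controls, and the continuity of the energy\<close>

text \<open>The steepest admissible climb from a to b has width \<epsilon> (b - a); the last
  assumption makes it fit strictly inside either half of the interval.\<close>

locale profile_problem =
  fixes a b \<epsilon> :: real
  assumes a_less_b: "a < b" and eps_pos: "0 < \<epsilon>" and eps_small: "\<epsilon> * (b - a) < 1 / 2"
begin

text \<open>Profiles with finite functional are parametrized by \<open>u = \<epsilon> \<phi>\<^sub>x\<close>.\<close>

definition controls :: "(real \<Rightarrow> real) set" where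
  "controls = {u \<in> borel_measurable unit_lebesgue.
     (\<forall>x. 0 \<le> u x \<and> u x \<le> 1) \<and> (LINT x|unit_lebesgue. u x) = \<epsilon> * (b - a)}"

text \<open>Integrating over \<open>{..x}\<close> defines the profile of a control on the whole
  line, with value a left of 0 and b right of 1, so that it is monotone there and hence
  Borel.\<close>

definition profile :: "(real \<Rightarrow> real) \<Rightarrow> real \<Rightarrow> real" where
  "profile u x = a + (LINT y|unit_lebesgue. indicator {..x} y * u y) / \<epsilon>"

text \<open>The entropy of \<rho> is left out because it does not depend on u;
  \<open>G_functional_profile\<close> restores it.\<close>

definition energy :: "(real \<Rightarrow> real) \<Rightarrow> (real \<Rightarrow> real) \<Rightarrow> real" where
  "energy \<rho> u = (LINT x|unit_lebesgue.
     binary_entropy (u x) + (1 - \<rho> x) * profile u x - softplus (profile u x))"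

lemma controlsD:
  assumes "u \<in> controls"
  shows "u \<in> borel_measurable unit_lebesgue" "0 \<le> u x" "u x \<le> 1"
    "(LINT x|unit_lebesgue. u x) = \<epsilon> * (b - a)"
  using assms by (auto simp: controls_def)

lemma integrable_control_mult:
  assumes "u \<in> controls" "A \<in> sets borel"
  shows "integrable unit_lebesgue (\<lambda>y. indicator A y * u y)"
proof (rule integrable_unit_lebesgue[where B=1])
  have [measurable]: "A \<in> sets borel" "u \<in> borel_measurable unit_lebesgue"
    using assms controlsD by auto
  have [measurable]: "(indicator A :: real \<Rightarrow> real) \<in> borel_measurable unit_lebesgue"
    by (intro measurable_unit_lebesgue) simp
  show "(\<lambda>y. indicator A y * u y) \<in> borel_measurable unit_lebesgue" by measurable
  show "\<bar>indicator A y * u y\<bar> \<le> 1" for y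
    using controlsD(2,3)[OF assms(1)] by (simp add: indicator_def)
qed

lemma integrable_control: "u \<in> controls \<Longrightarrow> integrable unit_lebesgue u"
  using integrable_control_mult[of u UNIV] by simp

lemma profile_bounds:
  assumes "u \<in> controls"
  shows "a \<le> profile u x" "profile u x \<le> b"
proof -
  have "0 \<le> (LINT y|unit_lebesgue. indicator {..x} y * u y)"
    using controlsD[OF assms] by (intro integral_nonneg_AE) auto
  then show "a \<le> profile u x" using eps_pos by (simp add: profile_def)
  have "(LINT y|unit_lebesgue. indicator {..x} y * u y) \<le> (LINT y|unit_lebesgue. u y)"
    using controlsD[OF assms] assms
    by (intro integral_mono integrable_control_mult integrable_control) (auto simp: indicator_def)
  then show "profile u x \<le> b"
    using eps_pos by (simp add: profile_def controlsD(4)[OF assms] field_simps)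
qed

lemma profile_diff:
  assumes "u \<in> controls" "x \<le> y"
  shows "profile u y - profile u x = (LINT z|unit_lebesgue. indicator {x<..y} z * u z) / \<epsilon>"
proof -
  have "(LINT z|unit_lebesgue. indicator {x<..y} z * u z)
      = (LINT z|unit_lebesgue. indicator {..y} z * u z - indicator {..x} z * u z)"
    using assms(2) by (intro Bochner_Integration.integral_cong) (auto simp: indicator_def)
  also have "\<dots> = (LINT z|unit_lebesgue. indicator {..y} z * u z) - (LINT z|unit_lebesgue. indicator {..x} z * u z)"
    using assms by (intro Bochner_Integration.integral_diff integrable_control_mult) auto
  finally show ?thesis by (simp add: profile_def diff_divide_distrib)
qed

lemma profile_mono:
  assumes "u \<in> controls" "x \<le> y" shows "profile u x \<le> profile u y"
proof -
  have "0 \<le> (LINT z|unit_lebesgue. indicator {x<..y} z * u z)"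
    using controlsD[OF assms(1)] by (intro integral_nonneg_AE) auto
  then show ?thesis using profile_diff[OF assms] eps_pos
    by (metis diff_ge_0_iff_ge divide_nonneg_pos)
qed

lemma measurable_profile:
  assumes "u \<in> controls" shows "profile u \<in> borel_measurable borel"
  using profile_mono[OF assms] by (intro borel_measurable_mono) (auto simp: mono_def)

text \<open>The bound u \<le> 1 caps the slope at 1/\<epsilon> for all controls at once, which
  supplies the equicontinuity for Arzela-Ascoli.\<close>

lemma profile_Lipschitz:
  assumes "u \<in> controls" "0 \<le> x" "x \<le> 1" "0 \<le> y" "y \<le> 1"
  shows "\<bar>profile u x - profile u y\<bar> \<le> \<bar>x - y\<bar> / \<epsilon>"
proof -
  have *: "profile u y - profile u x \<le> (y - x) / \<epsilon>" if "0 \<le> x" "x \<le> y" "y \<le> 1" for x y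
  proof -
    have "(LINT z|unit_lebesgue. indicator {x<..y} z * u z) \<le> (LINT z|unit_lebesgue. indicator {x<..y} z)"
      using controlsD[OF assms(1)] assms(1)
      by (intro integral_mono integrable_control_mult integrable_unit_lebesgue[where B=1])
        (auto simp: indicator_def intro!: measurable_unit_lebesgue)
    also have "\<dots> = y - x"
      using that by (subst integral_indicator_unit_lebesgue) auto
    finally show ?thesis
      using profile_diff[OF assms(1) that(2)] eps_pos by (simp add: divide_right_mono)
  qed
  show ?thesis
  proof (cases "x \<le> y")
    case True
    with *[of x y] profile_mono[OF assms(1) True] assms show ?thesis by simp
  next
    case False
    with *[of y x] profile_mono[OF assms(1), of y x] assms show ?thesis by simp
  qed
qed

lemma midpoint_controls:
  assumes "u \<in> controls" "v \<in> controls"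
  shows "(\<lambda>x. (u x + v x) / 2) \<in> controls"
proof -
  have [measurable]: "u \<in> borel_measurable unit_lebesgue" "v \<in> borel_measurable unit_lebesgue"
    using assms controlsD by auto
  have "(LINT x|unit_lebesgue. (u x + v x) / 2) = \<epsilon> * (b - a)"
    using assms controlsD(4)[OF assms(1)] controlsD(4)[OF assms(2)]
    by (simp add: integrable_control)
  moreover have "0 \<le> (u x + v x) / 2 \<and> (u x + v x) / 2 \<le> 1" for x
    using controlsD(2,3)[OF assms(1), of x] controlsD(2,3)[OF assms(2), of x] by simp
  ultimately show ?thesis by (simp add: controls_def)
qed

lemma profile_midpoint:
  assumes "u \<in> controls" "v \<in> controls"
  shows "profile (\<lambda>x. (u x + v x) / 2) x = (profile u x + profile v x) / 2"
proof -
  have "(LINT y|unit_lebesgue. indicator {..x} y * ((u y + v y) / 2))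
    = (LINT y|unit_lebesgue. (indicator {..x} y * u y + indicator {..x} y * v y) / 2)"
    by (intro Bochner_Integration.integral_cong) (auto simp: field_simps)
  also have "\<dots> = ((LINT y|unit_lebesgue. indicator {..x} y * u y) + (LINT y|unit_lebesgue. indicator {..x} y * v y)) / 2"
    using assms by (simp add: integrable_control_mult)
  finally show ?thesis by (simp add: profile_def add_divide_distrib)
qed

lemma integrable_entropy:
  assumes "u \<in> controls"
  shows "integrable unit_lebesgue (\<lambda>x. binary_entropy (u x))"
proof (rule integrable_unit_lebesgue[where B=1])
  have [measurable]: "u \<in> borel_measurable unit_lebesgue"
    using assms controlsD by auto
  show "(\<lambda>x. binary_entropy (u x)) \<in> borel_measurable unit_lebesgue" by measurable
  show "\<bar>binary_entropy (u x)\<bar> \<le> 1" for x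
    using binary_entropy_nonpos[of "u x"] binary_entropy_ge_minus_one[of "u x"] controlsD(2,3)[OF assms, of x]
    by simp
qed

lemma integrable_bounded_potential:
  fixes \<phi> \<rho> :: "real \<Rightarrow> real"
  assumes [measurable]: "\<phi> \<in> borel_measurable unit_lebesgue" "\<rho> \<in> borel_measurable unit_lebesgue"
    and "\<And>x. 0 \<le> \<rho> x \<and> \<rho> x \<le> 1" "\<And>x. x \<in> {0..1} \<Longrightarrow> a \<le> \<phi> x \<and> \<phi> x \<le> b"
  shows "integrable unit_lebesgue (\<lambda>x. (1 - \<rho> x) * \<phi> x - softplus (\<phi> x))"
proof (rule integrable_unit_lebesgue[where B="\<bar>a\<bar> + \<bar>b\<bar> + \<bar>softplus a\<bar> + \<bar>softplus b\<bar>"])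
  show "(\<lambda>x. (1 - \<rho> x) * \<phi> x - softplus (\<phi> x)) \<in> borel_measurable unit_lebesgue" by measurable
  fix x :: real assume x: "x \<in> {0..1}"
  have "\<bar>(1 - \<rho> x) * \<phi> x\<bar> \<le> 1 * \<bar>\<phi> x\<bar>"
    unfolding abs_mult using assms(3)[of x] by (intro mult_right_mono) auto
  moreover have "softplus a \<le> softplus (\<phi> x)" "softplus (\<phi> x) \<le> softplus b"
    using assms(4)[OF x] softplus_strict_increasing[of a "\<phi> x"] softplus_strict_increasing[of "\<phi> x" b]
    by (cases "\<phi> x = a"; cases "\<phi> x = b"; force)+
  ultimately show "\<bar>(1 - \<rho> x) * \<phi> x - softplus (\<phi> x)\<bar> \<le> \<bar>a\<bar> + \<bar>b\<bar> + \<bar>softplus a\<bar> + \<bar>softplus b\<bar>"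
    using assms(4)[OF x] by linarith
qed

definition potential :: "(real \<Rightarrow> real) \<Rightarrow> (real \<Rightarrow> real) \<Rightarrow> real" where
  "potential \<rho> \<phi> = (LINT x|unit_lebesgue. (1 - \<rho> x) * \<phi> x - softplus (\<phi> x))"

text \<open>Bounds at every point, in place of the almost-everywhere bounds in
  \<open>densities\<close>, allow pointwise estimates of the integrands.\<close>

definition unit_weights :: "(real \<Rightarrow> real) set" where
  "unit_weights = {\<rho> \<in> borel_measurable unit_lebesgue. \<forall>x. 0 \<le> \<rho> x \<and> \<rho> x \<le> 1}"

lemma integrable_potential:
  assumes "u \<in> controls" "\<rho> \<in> unit_weights"
  shows "integrable unit_lebesgue (\<lambda>x. (1 - \<rho> x) * profile u x - softplus (profile u x))"
  using assms profile_bounds[OF assms(1)]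
  by (intro integrable_bounded_potential measurable_unit_lebesgue[OF measurable_profile])
    (auto simp: unit_weights_def)

lemma energy_split:
  assumes "u \<in> controls" "\<rho> \<in> unit_weights"
  shows "energy \<rho> u = (LINT x|unit_lebesgue. binary_entropy (u x)) + potential \<rho> (profile u)"
  unfolding energy_def potential_def add_diff_eq[symmetric]
  by (intro Bochner_Integration.integral_add integrable_entropy integrable_potential assms)

text \<open>The linear term and \<open>softplus\<close> each have Lipschitz constant at most
  1.\<close>

lemma potential_integrand_Lipschitz:
  assumes "\<rho> \<in> unit_weights"
  shows "\<bar>((1 - \<rho> x) * p - softplus p) - ((1 - \<rho> x) * q - softplus q)\<bar> \<le> 2 * \<bar>p - q\<bar>"
proof -
  have "\<bar>(1 - \<rho> x) * (p - q)\<bar> \<le> 1 * \<bar>p - q\<bar>"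
    unfolding abs_mult using assms by (intro mult_right_mono) (auto simp: unit_weights_def)
  moreover have "(1 - \<rho> x) * (p - q) = (1 - \<rho> x) * p - (1 - \<rho> x) * q" by (simp add: algebra_simps)
  moreover have "\<bar>A\<bar> \<le> 1 * d \<Longrightarrow> A = B - C \<Longrightarrow> \<bar>s - t\<bar> \<le> d \<Longrightarrow> \<bar>(B - s) - (C - t)\<bar> \<le> 2 * d"
    for A B C s t d :: real by linarith
  ultimately show ?thesis using softplus_Lipschitz[of p q] by blast
qed

lemma potential_diff_le:
  assumes "u \<in> controls" "v \<in> controls" "\<rho> \<in> unit_weights"
    "\<And>x. x \<in> {0..1} \<Longrightarrow> \<bar>profile u x - profile v x\<bar> \<le> d"
  shows "\<bar>potential \<rho> (profile u) - potential \<rho> (profile v)\<bar> \<le> 2 * d"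
proof -
  have *: "potential \<rho> (profile u) \<le> potential \<rho> (profile v) + 2 * d"
    if uv: "u \<in> controls" "v \<in> controls"
      and d: "\<And>x. x \<in> {0..1} \<Longrightarrow> \<bar>profile u x - profile v x\<bar> \<le> d" for u v
  proof -
    have "potential \<rho> (profile u)
      \<le> (LINT x|unit_lebesgue. ((1 - \<rho> x) * profile v x - softplus (profile v x)) + 2 * d)"
      unfolding potential_def
    proof (intro integral_unit_lebesgue_mono integrable_potential Bochner_Integration.integrable_add uv assms)
      fix x :: real assume "x \<in> {0..1}"
      moreover have "\<bar>P - Q\<bar> \<le> 2 * r \<Longrightarrow> r \<le> d \<Longrightarrow> P \<le> Q + 2 * d" for P Q r :: real
        by linarith
      ultimately show "(1 - \<rho> x) * profile u x - softplus (profile u x)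
        \<le> (1 - \<rho> x) * profile v x - softplus (profile v x) + 2 * d"
        using d potential_integrand_Lipschitz[OF assms(3)] by blast
    qed simp
    also have "\<dots> = potential \<rho> (profile v) + 2 * d"
      unfolding potential_def
      by (subst Bochner_Integration.integral_add) (auto intro: integrable_potential uv assms)
    finally show ?thesis .
  qed
  have "\<And>x. x \<in> {0..1} \<Longrightarrow> \<bar>profile v x - profile u x\<bar> \<le> d"
    using assms(4) by (simp add: abs_minus_commute)
  with *[of u v] *[of v u] assms show ?thesis by force
qed

section \<open>Minimizers under a one-sided constraint at 1/2\<close>

text \<open>The sign \<sigma> = 1 keeps the profile at or above the midpoint at 1/2, \<sigma> = -1
  at or below it. The constraint is affine in u, hence stable under averages and limits, which is
  all that the existence proof asks of the class.\<close>

definition half_class :: "real \<Rightarrow> (real \<Rightarrow> real) set" where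
  "half_class \<sigma> = {u \<in> controls. 0 \<le> \<sigma> * (profile u (1/2) - (a + b) / 2)}"

lemma midpoint_half_class:
  assumes "u \<in> half_class \<sigma>" "v \<in> half_class \<sigma>"
  shows "(\<lambda>x. (u x + v x) / 2) \<in> half_class \<sigma>"
proof -
  have "\<sigma> * ((profile u (1/2) + profile v (1/2)) / 2 - (a + b) / 2)
     = (\<sigma> * (profile u (1/2) - (a + b) / 2) + \<sigma> * (profile v (1/2) - (a + b) / 2)) / 2"
    by (simp add: field_simps)
  then show ?thesis
    using assms by (simp add: half_class_def midpoint_controls profile_midpoint)
qed

lemma integrable_square_diff:
  assumes "u \<in> controls" "v \<in> controls"
  shows "integrable unit_lebesgue (\<lambda>x. (u x - v x)\<^sup>2)"
proof (rule integrable_unit_lebesgue[where B=1])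
  have [measurable]: "u \<in> borel_measurable unit_lebesgue" "v \<in> borel_measurable unit_lebesgue"
    using assms controlsD by auto
  show "(\<lambda>x. (u x - v x)\<^sup>2) \<in> borel_measurable unit_lebesgue" by measurable
  show "\<bar>(u x - v x)\<^sup>2\<bar> \<le> 1" for x
    using controlsD(2,3)[OF assms(1), of x] controlsD(2,3)[OF assms(2), of x]
    by (simp add: abs_square_le_1)
qed

text \<open>Strong convexity of the entropy produces the L^2 gain. The potential is not convex, but
  the averaged profile is within d/2 of both profiles, so the Lipschitz constant 2 limits the damage
  to d.\<close>

lemma energy_midpoint:
  assumes "u \<in> controls" "v \<in> controls" "\<rho> \<in> unit_weights"
    and d: "\<And>x. x \<in> {0..1} \<Longrightarrow> \<bar>profile u x - profile v x\<bar> \<le> d"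
  shows "energy \<rho> (\<lambda>x. (u x + v x) / 2)
     \<le> (energy \<rho> u + energy \<rho> v) / 2 - (LINT x|unit_lebesgue. (u x - v x)\<^sup>2) / 16 + d"
proof -
  let ?w = "\<lambda>x. (u x + v x) / 2"
  have w: "?w \<in> controls" using assms midpoint_controls by blast
  have [measurable]: "u \<in> borel_measurable unit_lebesgue" "v \<in> borel_measurable unit_lebesgue"
    using assms controlsD by auto
  have sq: "integrable unit_lebesgue (\<lambda>x. (u x - v x)\<^sup>2)"
    using assms by (intro integrable_square_diff)
  have "(LINT x|unit_lebesgue. binary_entropy (?w x))
     \<le> (LINT x|unit_lebesgue. (binary_entropy (u x) + binary_entropy (v x)) / 2 - (u x - v x)\<^sup>2 / 16)"
    using assms w sq controlsD(2,3)[OF assms(1)] controlsD(2,3)[OF assms(2)]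
    by (intro integral_unit_lebesgue_mono binary_entropy_midpoint Bochner_Integration.integrable_diff
        integrable_divide Bochner_Integration.integrable_add integrable_entropy) auto
  also have "\<dots> = ((LINT x|unit_lebesgue. binary_entropy (u x)) + (LINT x|unit_lebesgue. binary_entropy (v x))) / 2
      - (LINT x|unit_lebesgue. (u x - v x)\<^sup>2) / 16"
    using assms sq by (simp add: integrable_entropy)
  finally have 1: "(LINT x|unit_lebesgue. binary_entropy (?w x)) \<le> \<dots>" .
  have *: "\<bar>potential \<rho> (profile ?w) - potential \<rho> (profile z)\<bar> \<le> 2 * (d / 2)"
    if "z = u \<or> z = v" for z
  proof (rule potential_diff_le[OF w _ assms(3)])
    show "z \<in> controls" using that assms by auto
    fix x :: real assume "x \<in> {0..1}"
    with d[of x] that show "\<bar>profile ?w x - profile z x\<bar> \<le> d / 2"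
      using assms by (auto simp: profile_midpoint abs_le_iff field_simps)
  qed
  have "potential \<rho> (profile ?w) \<le> (potential \<rho> (profile u) + potential \<rho> (profile v)) / 2 + d"
    using *[of u] *[of v] by (simp add: abs_le_iff field_simps)
  with 1 show ?thesis
    unfolding energy_split[OF w assms(3)] energy_split[OF assms(1,3)] energy_split[OF assms(2,3)]
    by (simp add: field_simps)
qed

lemma energy_lower_bound:
  assumes "u \<in> controls" "w \<in> controls" "\<rho> \<in> unit_weights"
  shows "potential \<rho> (profile w) - 2 * (b - a) - 1 \<le> energy \<rho> u"
proof -
  have "(LINT x|unit_lebesgue. -1) \<le> (LINT x|unit_lebesgue. binary_entropy (u x))"
    using controlsD(2,3)[OF assms(1)]
    by (intro integral_unit_lebesgue_mono integrable_entropy binary_entropy_ge_minus_one assms) auto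
  moreover have "\<bar>potential \<rho> (profile u) - potential \<rho> (profile w)\<bar> \<le> 2 * (b - a)"
    using profile_bounds[OF assms(1)] profile_bounds[OF assms(2)]
    by (intro potential_diff_le assms) (auto simp: abs_le_iff intro!: diff_mono)
  ultimately show ?thesis
    unfolding energy_split[OF assms(1,3)] abs_le_iff by simp
qed

text \<open>Along a subsequence with uniformly close profiles, the averages stay in the class and
  cannot fall below the infimum, so \<open>energy_midpoint\<close> forces the L^2 distances of the
  controls to 0. Almost everywhere convergence of a further subsequence then lets the entropy
  integral pass to the limit by dominated convergence.\<close>

lemma exists_minimizer:
  assumes \<rho>: "\<rho> \<in> unit_weights" and ne: "half_class \<sigma> \<noteq> {}"
  obtains u where "u \<in> half_class \<sigma>" "\<And>v. v \<in> half_class \<sigma> \<Longrightarrow> energy \<rho> u \<le> energy \<rho> v"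
proof -
  have sub: "u \<in> controls" if "u \<in> half_class \<sigma>" for u using that by (simp add: half_class_def)
  define I where "I = Inf (energy \<rho> ` half_class \<sigma>)"
  obtain w where w: "w \<in> half_class \<sigma>" using ne by blast
  have bdd: "bdd_below (energy \<rho> ` half_class \<sigma>)"
    using energy_lower_bound[OF sub sub[OF w] \<rho>] unfolding bdd_below_def by blast
  have I_le: "I \<le> energy \<rho> u" if "u \<in> half_class \<sigma>" for u
    unfolding I_def using that bdd by (intro cInf_lower) auto
  have "\<exists>u\<in>half_class \<sigma>. energy \<rho> u < I + 1 / real (Suc n)" for n
  proof -
    have "\<exists>y\<in>energy \<rho> ` half_class \<sigma>. y < I + 1 / real (Suc n)"
      unfolding I_def by (intro cInf_lessD) (use ne in auto)
    then show ?thesis by blast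
  qed
  then obtain v where v: "\<And>n. v n \<in> half_class \<sigma>" "\<And>n. energy \<rho> (v n) < I + 1 / real (Suc n)"
    by metis
  have lim_I: "(\<lambda>n. energy \<rho> (v n)) \<longlonglongrightarrow> I"
  proof (rule tendsto_sandwich[where f="\<lambda>_. I" and h="\<lambda>n. I + 1 / real (Suc n)"])
    show "(\<lambda>n. I + 1 / real (Suc n)) \<longlonglongrightarrow> I" by real_asymp
    show "\<forall>\<^sub>F n in sequentially. I \<le> energy \<rho> (v n)" using v I_le by simp
    show "\<forall>\<^sub>F n in sequentially. energy \<rho> (v n) \<le> I + 1 / real (Suc n)"
      using v(2) by (intro always_eventually allI less_imp_le)
  qed simp

  obtain g k where k: "strict_mono (k :: nat \<Rightarrow> nat)"
    and unif: "\<And>e. 0 < e \<Longrightarrow> \<exists>N. \<forall>n x. n \<ge> N \<and> x \<in> {0..1} \<longrightarrow> norm (profile (v (k n)) x - g x) < e"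
  proof (rule Arzela_Ascoli[of "{0..1::real}" "\<lambda>n. profile (v n)" "\<bar>a\<bar> + \<bar>b\<bar>"])
    show "norm (profile (v n) x) \<le> \<bar>a\<bar> + \<bar>b\<bar>" for n x
      using profile_bounds[OF sub[OF v(1)], of n x] by auto
    fix x e :: real assume x: "x \<in> {0..1}" and e: "0 < e"
    have "\<bar>profile (v n) x - profile (v n) y\<bar> < e" if "y \<in> {0..1}" "\<bar>x - y\<bar> < \<epsilon> * e" for n y
    proof -
      have "\<bar>profile (v n) x - profile (v n) y\<bar> \<le> \<bar>x - y\<bar> / \<epsilon>"
        using that x by (intro profile_Lipschitz sub[OF v(1)]) auto
      also have "\<dots> < e" using that eps_pos by (simp add: field_simps)
      finally show ?thesis .
    qed
    then show "\<exists>d>0. \<forall>n y. y \<in> {0..1} \<and> norm (x - y) < d \<longrightarrow> norm (profile (v n) x - profile (v n) y) < e"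
      using e eps_pos by (intro exI[of _ "\<epsilon> * e"]) auto
  qed auto

  define s where "s n = v (k n)" for n
  have s: "s n \<in> half_class \<sigma>" "s n \<in> controls" for n using v sub by (auto simp: s_def)
  have s_meas [measurable]: "s n \<in> borel_measurable unit_lebesgue" for n using s controlsD by auto
  have s01: "0 \<le> s n x" "s n x \<le> 1" for n x using controlsD(2,3)[OF s(2)] by auto
  have cauchy: "\<exists>N. \<forall>i\<ge>N. \<forall>j\<ge>N. (LINT x|unit_lebesgue. norm (s i x - s j x)) < e" if "0 < e" for e
  proof -
    \<comment> \<open>The midpoint estimate will give \<open>?Q \<le> 48 * h\<close>, that is e^2 /
      2, so that the final bound (e + e/2) / 2 is below e.\<close>
    define h where "h = e\<^sup>2 / 96"
    have h: "0 < h" using that by (simp add: h_def)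
    obtain N1 where N1: "\<And>n x. n \<ge> N1 \<Longrightarrow> x \<in> {0..1} \<Longrightarrow> \<bar>profile (s n) x - g x\<bar> < h"
      using unif[OF h] by (auto simp: s_def)
    have "(\<lambda>n. energy \<rho> (s n)) \<longlonglongrightarrow> I"
      unfolding s_def using LIMSEQ_subseq_LIMSEQ[OF lim_I k] by (simp add: o_def)
    then obtain N2 where N2: "\<And>n. n \<ge> N2 \<Longrightarrow> \<bar>energy \<rho> (s n) - I\<bar> < h"
      using h unfolding LIMSEQ_def dist_real_def by blast
    have "(LINT x|unit_lebesgue. norm (s i x - s j x)) < e" if ij: "i \<ge> max N1 N2" "j \<ge> max N1 N2" for i j
    proof -
      let ?Q = "LINT x|unit_lebesgue. (s i x - s j x)\<^sup>2"
      have "I \<le> energy \<rho> (\<lambda>x. (s i x + s j x) / 2)"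
        by (intro I_le midpoint_half_class s)
      also have "\<dots> \<le> (energy \<rho> (s i) + energy \<rho> (s j)) / 2 - ?Q / 16 + 2 * h"
      proof (intro energy_midpoint s \<rho>)
        fix x :: real assume "x \<in> {0..1}"
        then show "\<bar>profile (s i) x - profile (s j) x\<bar> \<le> 2 * h"
          using N1[of i x] N1[of j x] ij by auto
      qed
      finally have Q: "?Q \<le> 48 * h"
        using N2[of i] N2[of j] ij by (auto simp: field_simps abs_less_iff)
      have "(LINT x|unit_lebesgue. norm (s i x - s j x))
          \<le> (LINT x|unit_lebesgue. (e + (s i x - s j x)\<^sup>2 / e) / 2)"
      proof (rule integral_unit_lebesgue_mono)
        show "integrable unit_lebesgue (\<lambda>x. norm (s i x - s j x))"
          by (intro integrable_norm Bochner_Integration.integrable_diff integrable_control s)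
        show "integrable unit_lebesgue (\<lambda>x. (e + (s i x - s j x)\<^sup>2 / e) / 2)"
          by (intro integrable_divide Bochner_Integration.integrable_add integrable_square_diff s) simp
        fix x
        \<comment> \<open>Weighted arithmetic-geometric mean, which passes from the L^2 to the L^1
          distance in place of Cauchy-Schwarz.\<close>
        have "0 \<le> (e - \<bar>s i x - s j x\<bar>)\<^sup>2" by simp
        then show "norm (s i x - s j x) \<le> (e + (s i x - s j x)\<^sup>2 / e) / 2"
          using \<open>0 < e\<close> by (simp add: power2_diff power2_eq_square field_simps)
      qed
      also have "\<dots> = (e + ?Q / e) / 2"
        by (simp add: integrable_square_diff s)
      also have "\<dots> \<le> (e + 48 * h / e) / 2"
        using Q \<open>0 < e\<close> by (intro divide_right_mono add_left_mono) auto
      also have "\<dots> < e" using \<open>0 < e\<close> by (simp add: h_def power2_eq_square)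
      finally show ?thesis .
    qed
    then show ?thesis by blast
  qed
  obtain r where r: "strict_mono r" and ae: "AE x in unit_lebesgue. Cauchy (\<lambda>i. s (r i) x)"
    using cauchy_L1_AE_cauchy_subseq[of unit_lebesgue s] cauchy integrable_control s by blast
  define t where "t i = s (r i)" for i
  have t: "t i \<in> half_class \<sigma>" "t i \<in> controls" for i using s by (auto simp: t_def)
  have [measurable]: "t i \<in> borel_measurable unit_lebesgue" for i by (simp add: t_def)
  have t01: "0 \<le> t n x" "t n x \<le> 1" for n x using s01 by (auto simp: t_def)
  \<comment> \<open>Where the sequence diverges \<open>lim\<close> is arbitrary; clipping keeps the
    values in [0,1] everywhere and changes nothing at points of convergence.\<close>
  define u where "u x = max 0 (min 1 (lim (\<lambda>i. t i x)))" for x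
  have u_meas [measurable]: "u \<in> borel_measurable unit_lebesgue"
    unfolding u_def by measurable
  have u01: "0 \<le> u x" "u x \<le> 1" for x by (auto simp: u_def)
  have u_lim: "AE x in unit_lebesgue. (\<lambda>i. t i x) \<longlonglongrightarrow> u x"
    using ae
  proof eventually_elim
    case (elim x)
    then have l: "(\<lambda>i. t i x) \<longlonglongrightarrow> lim (\<lambda>i. t i x)"
      by (simp add: t_def Cauchy_convergent_iff convergent_LIMSEQ_iff)
    then have "0 \<le> lim (\<lambda>i. t i x)" "lim (\<lambda>i. t i x) \<le> 1"
      using t01 by (auto intro: LIMSEQ_le_const LIMSEQ_le_const2)
    then show ?case using l by (simp add: u_def)
  qed
  have lim_ind: "(\<lambda>i. LINT y|unit_lebesgue. indicator A y * t i y) \<longlonglongrightarrow> (LINT y|unit_lebesgue. indicator A y * u y)"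
    if [measurable]: "A \<in> sets borel" for A :: "real set"
  proof (rule integral_dominated_convergence[where w="\<lambda>_. 1"])
    have [measurable]: "(indicator A :: real \<Rightarrow> real) \<in> borel_measurable unit_lebesgue"
      by (intro measurable_unit_lebesgue) simp
    show "(\<lambda>y. indicator A y * u y) \<in> borel_measurable unit_lebesgue" by measurable
    show "(\<lambda>y. indicator A y * t i y) \<in> borel_measurable unit_lebesgue" for i by measurable
    show "AE x in unit_lebesgue. (\<lambda>i. indicator A x * t i x) \<longlonglongrightarrow> indicator A x * u x"
      using u_lim by eventually_elim (auto intro: tendsto_mult_left)
    show "AE x in unit_lebesgue. norm (indicator A x * t i x) \<le> 1" for i
      using t01 by (auto simp: indicator_def)
  qed simp
  have "(\<lambda>i. LINT y|unit_lebesgue. t i y) \<longlonglongrightarrow> (LINT y|unit_lebesgue. u y)"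
    using lim_ind[of UNIV] by simp
  then have "(LINT y|unit_lebesgue. u y) = \<epsilon> * (b - a)"
    unfolding controlsD(4)[OF t(2)] by (simp add: LIMSEQ_const_iff)
  then have u: "u \<in> controls" using u01 by (simp add: controls_def)
  have prof_lim: "(\<lambda>i. profile (t i) x) \<longlonglongrightarrow> profile u x" for x
    unfolding profile_def using eps_pos by (intro tendsto_intros lim_ind) auto
  have "0 \<le> \<sigma> * (profile u (1/2) - (a + b) / 2)"
  proof (rule LIMSEQ_le_const)
    show "(\<lambda>i. \<sigma> * (profile (t i) (1/2) - (a + b) / 2)) \<longlonglongrightarrow> \<sigma> * (profile u (1/2) - (a + b) / 2)"
      by (intro tendsto_intros prof_lim)
  qed (use t in \<open>auto simp: half_class_def\<close>)
  then have u_half: "u \<in> half_class \<sigma>" using u by (simp add: half_class_def)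
  have ent_lim: "(\<lambda>i. LINT y|unit_lebesgue. binary_entropy (t i y)) \<longlonglongrightarrow> (LINT y|unit_lebesgue. binary_entropy (u y))"
  proof (rule integral_dominated_convergence[where w="\<lambda>_. 1"])
    show "AE x in unit_lebesgue. (\<lambda>i. binary_entropy (t i x)) \<longlonglongrightarrow> binary_entropy (u x)"
      using u_lim
      by eventually_elim (auto intro!: continuous_on_tendsto_compose[OF continuous_on_binary_entropy]
          simp: t01 u01)
    show "AE x in unit_lebesgue. norm (binary_entropy (t i x)) \<le> 1" for i
      using binary_entropy_nonpos[OF t01] binary_entropy_ge_minus_one[OF t01]
      by (auto simp: abs_le_iff intro: order_trans)
    show "(\<lambda>y. binary_entropy (u y)) \<in> borel_measurable unit_lebesgue"
      "(\<lambda>y. binary_entropy (t i y)) \<in> borel_measurable unit_lebesgue" for i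
      by measurable
  qed simp
  \<comment> \<open>The uniform limit from Arzela-Ascoli is the profile of the limit control, so the
    profiles converge uniformly to it and the potential follows.\<close>
  have g: "profile u x = g x" if "x \<in> {0..1}" for x
  proof -
    have "(\<lambda>n. profile (s n) x) \<longlonglongrightarrow> g x"
      unfolding LIMSEQ_def dist_real_def using unif that by (fastforce simp: s_def)
    from LIMSEQ_subseq_LIMSEQ[OF this r] have "(\<lambda>n. profile (t n) x) \<longlonglongrightarrow> g x"
      by (simp add: o_def t_def)
    with prof_lim show ?thesis by (rule LIMSEQ_unique)
  qed
  have pot_lim: "(\<lambda>i. potential \<rho> (profile (t i))) \<longlonglongrightarrow> potential \<rho> (profile u)"
    unfolding LIMSEQ_def dist_real_def
  proof (intro allI impI)
    fix e :: real assume e: "0 < e"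
    then obtain N where N: "\<And>n x. n \<ge> N \<Longrightarrow> x \<in> {0..1} \<Longrightarrow> \<bar>profile (s n) x - g x\<bar> < e / 3"
      using unif[of "e / 3"] by (auto simp: s_def)
    have "\<bar>potential \<rho> (profile (t n)) - potential \<rho> (profile u)\<bar> < e" if "n \<ge> N" for n
    proof -
      have "r n \<ge> N" using that seq_suble[OF r, of n] by simp
      then have "\<bar>potential \<rho> (profile (t n)) - potential \<rho> (profile u)\<bar> \<le> 2 * (e / 3)"
        using N by (intro potential_diff_le t u \<rho>) (auto simp: t_def g intro: less_imp_le)
      with e show ?thesis by simp
    qed
    then show "\<exists>no. \<forall>n\<ge>no. \<bar>potential \<rho> (profile (t n)) - potential \<rho> (profile u)\<bar> < e" by blast
  qed
  have "(\<lambda>i. energy \<rho> (t i)) \<longlonglongrightarrow> energy \<rho> u"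
    unfolding energy_split[OF t(2) \<rho>] energy_split[OF u \<rho>] by (intro tendsto_add ent_lim pot_lim)
  moreover have "(\<lambda>i. energy \<rho> (t i)) \<longlonglongrightarrow> I"
    using LIMSEQ_subseq_LIMSEQ[OF LIMSEQ_subseq_LIMSEQ[OF lim_I k] r] by (simp add: t_def s_def o_def)
  ultimately have "energy \<rho> u = I" by (rule LIMSEQ_unique)
  with that u_half I_le show thesis by metis
qed

end

text \<open>The constant value of \<open>\<rho>\<close> at which the constant profiles \<open>a\<close> and \<open>b\<close> cost the same.\<close>

definition balance :: "real \<Rightarrow> real \<Rightarrow> real" where
  "balance a b = 1 - (softplus b - softplus a) / (b - a)"

text \<open>The quotient is a secant slope of \<open>softplus\<close>. Strict bounds leave room to
  move \<rho> to both sides of this value within [0,1].\<close>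

lemma balance_bounds:
  assumes "a < b" shows "0 < balance a b" "balance a b < 1"
  using assms softplus_strict_increasing[OF assms] softplus_diff_less[OF assms]
  by (auto simp: balance_def field_simps)

text \<open>For c = \<open>balance a b\<close> and \<tau> = 0 the value b is the cheaper one on the
  left half and a on the right, opposite to the order in which an increasing profile takes them. A
  shift with |\<tau>| \<le> \<delta>/2 preserves this with margin \<delta>/2.\<close>

definition step_density :: "real \<Rightarrow> real \<Rightarrow> real \<Rightarrow> real \<Rightarrow> real" where
  "step_density c \<delta> \<tau> x = (if x < 1/2 then c + \<delta> else c - \<delta>) + \<tau>"

section \<open>Energy estimates: entropy, transition layers, concavity margin\<close>

context profile_problem
begin

text \<open>Integrated tangent at p, with 1 - u replaced by 1 in front of the negative number ln (1
  - p). Fixing a small p makes the second term small, and then \<epsilon> \<rightarrow> 0 removes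
  the first.\<close>

lemma entropy_integral_ge:
  assumes "u \<in> controls" "0 < p" "p < 1"
  shows "\<epsilon> * (b - a) * ln p + ln (1 - p) \<le> (LINT x|unit_lebesgue. binary_entropy (u x))"
proof -
  have "ln (1 - p) \<le> 0" using assms by simp
  have "\<epsilon> * (b - a) * ln p + ln (1 - p) = (LINT x|unit_lebesgue. u x * ln p + ln (1 - p))"
    using assms by (simp add: integrable_control controlsD(4))
  also have "\<dots> \<le> (LINT x|unit_lebesgue. binary_entropy (u x))"
  proof (rule integral_unit_lebesgue_mono)
    fix x
    note u = controlsD(2,3)[OF assms(1), of x]
    have "u x * ln (1 - p) \<le> 0" using u \<open>ln (1 - p) \<le> 0\<close> by (intro mult_nonneg_nonpos) auto
    moreover have "(1 - u x) * ln (1 - p) = ln (1 - p) - u x * ln (1 - p)" by (simp add: algebra_simps)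
    moreover have "0 \<le> (u x - p)\<^sup>2 / 4" by simp
    ultimately have "u x * ln p + ln (1 - p) \<le> u x * ln p + (1 - u x) * ln (1 - p) + (u x - p)\<^sup>2 / 4"
      by linarith
    also have "\<dots> \<le> binary_entropy (u x)" using u assms by (intro binary_entropy_ge) auto
    finally show "u x * ln p + ln (1 - p) \<le> binary_entropy (u x)" .
  qed (intro Bochner_Integration.integrable_add integrable_mult_left integrable_entropy
      integrable_control assms unit_lebesgue.integrable_const)+
  finally show ?thesis .
qed

lemma integrable_potential_const:
  assumes "\<rho> \<in> unit_weights" "c \<in> {a..b}"
  shows "integrable unit_lebesgue (\<lambda>x. (1 - \<rho> x) * c - softplus c)"
  using assms by (intro integrable_bounded_potential) (auto simp: unit_weights_def)

text \<open>A control with values 0 and 1 has zero entropy. Its profile differs from c only on T, by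
  at most b - a, and the potential integrand has Lipschitz constant 2.\<close>

lemma layer_energy_le:
  assumes u: "u \<in> controls" "\<And>x. u x = 0 \<or> u x = 1" and \<rho>: "\<rho> \<in> unit_weights" and c: "c \<in> {a..b}"
    and T: "T \<in> sets borel" "T \<subseteq> {0..1}" "\<And>x. x \<in> {0..1} \<Longrightarrow> x \<notin> T \<Longrightarrow> profile u x = c"
  shows "energy \<rho> u \<le> potential \<rho> (\<lambda>_. c) + 2 * (b - a) * measure lborel T"
proof -
  have [measurable]: "(indicator T :: real \<Rightarrow> real) \<in> borel_measurable unit_lebesgue"
    using T by (intro measurable_unit_lebesgue) simp
  have T_int: "integrable unit_lebesgue (\<lambda>x. 2 * (b - a) * indicator T x)"
  proof (rule integrable_unit_lebesgue[where B="2 * (b - a)"])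
    show "\<bar>2 * (b - a) * indicator T x\<bar> \<le> 2 * (b - a)" for x
      using a_less_b by (simp add: indicator_def)
  qed measurable
  have "binary_entropy (u x) = 0" for x
    using u(2)[of x] by (auto simp: binary_entropy_def)
  moreover have "potential \<rho> (profile u)
      \<le> (LINT x|unit_lebesgue. ((1 - \<rho> x) * c - softplus c) + 2 * (b - a) * indicator T x)"
    unfolding potential_def
  proof (intro integral_unit_lebesgue_mono integrable_potential Bochner_Integration.integrable_add
      integrable_potential_const u \<rho> c T_int)
    fix x :: real assume x: "x \<in> {0..1}"
    show "(1 - \<rho> x) * profile u x - softplus (profile u x)
       \<le> ((1 - \<rho> x) * c - softplus c) + 2 * (b - a) * indicator T x"
    proof (cases "x \<in> T")
      case True
      have "\<bar>profile u x - c\<bar> \<le> b - a"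
        using profile_bounds[OF u(1), of x] c by auto
      moreover have "\<bar>P - Q\<bar> \<le> 2 * r \<Longrightarrow> r \<le> d \<Longrightarrow> P \<le> Q + 2 * d" for P Q r d :: real
        by linarith
      ultimately have "(1 - \<rho> x) * profile u x - softplus (profile u x)
           \<le> ((1 - \<rho> x) * c - softplus c) + 2 * (b - a)"
        using potential_integrand_Lipschitz[OF \<rho>] by blast
      then show ?thesis using True by simp
    qed (use T(3)[OF x] in simp)
  qed
  moreover have "(LINT x|unit_lebesgue. ((1 - \<rho> x) * c - softplus c) + 2 * (b - a) * indicator T x)
      = potential \<rho> (\<lambda>_. c) + 2 * (b - a) * measure lborel T"
    unfolding potential_def
    using integrable_potential_const[OF \<rho> c] T_int integral_indicator_unit_lebesgue[OF T(1,2)]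
    by (subst Bochner_Integration.integral_add) simp_all
  ultimately show ?thesis using energy_split[OF u(1) \<rho>] by simp
qed

lemma indicator_in_controls:
  assumes "0 \<le> x" "x \<le> 1 - \<epsilon> * (b - a)"
  shows "indicator {x..x + \<epsilon> * (b - a)} \<in> controls"
proof -
  have "0 \<le> \<epsilon> * (b - a)" using eps_pos a_less_b by simp
  then have "(LINT y|unit_lebesgue. indicator {x..x + \<epsilon> * (b - a)} y :: real) = \<epsilon> * (b - a)"
    using assms by (subst integral_indicator_unit_lebesgue) auto
  moreover have "(indicator {x..x + \<epsilon> * (b - a)} :: real \<Rightarrow> real) \<in> borel_measurable unit_lebesgue"
    by (intro measurable_unit_lebesgue) simp
  ultimately show ?thesis unfolding controls_def by (simp add: indicator_le_1 del: integral_indicator)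
qed

text \<open>The profile climbs from a to b at the maximal slope 1/\<epsilon> right at the left
  endpoint and equals b by the time it reaches 1/2.\<close>

lemma early_layer:
  assumes "\<rho> \<in> unit_weights"
  obtains u where "u \<in> half_class 1"
    "energy \<rho> u \<le> potential \<rho> (\<lambda>_. b) + 2 * (b - a) * (\<epsilon> * (b - a))"
proof
  let ?w = "\<epsilon> * (b - a)"
  let ?u = "indicator {0..?w} :: real \<Rightarrow> real"
  have w: "0 < ?w" "?w < 1/2" using eps_pos a_less_b eps_small by auto
  have u: "?u \<in> controls" using indicator_in_controls[of 0] w by simp
  have prof: "profile ?u x = b" if "?w \<le> x" for x
  proof -
    have "(LINT y|unit_lebesgue. indicator {..x} y * ?u y) = (LINT y|unit_lebesgue. ?u y)"
      using that by (intro Bochner_Integration.integral_cong) (auto simp: indicator_def)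
    then show ?thesis using eps_pos by (simp only: profile_def controlsD(4)[OF u]) simp
  qed
  show "?u \<in> half_class 1"
    using u prof[of "1/2"] w a_less_b by (simp add: half_class_def)
  have "energy \<rho> ?u \<le> potential \<rho> (\<lambda>_. b) + 2 * (b - a) * measure lborel {0..?w}"
    using w a_less_b prof by (intro layer_energy_le u assms) (auto simp: indicator_def)
  then show "energy \<rho> ?u \<le> potential \<rho> (\<lambda>_. b) + 2 * (b - a) * ?w" using w by simp
qed

text \<open>Mirror image: the profile stays at a and climbs at the right endpoint.\<close>

lemma late_layer:
  assumes "\<rho> \<in> unit_weights"
  obtains u where "u \<in> half_class (-1)"
    "energy \<rho> u \<le> potential \<rho> (\<lambda>_. a) + 2 * (b - a) * (\<epsilon> * (b - a))"
proof
  let ?w = "\<epsilon> * (b - a)"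
  let ?u = "indicator {1 - ?w..1} :: real \<Rightarrow> real"
  have w: "0 < ?w" "?w < 1/2" using eps_pos a_less_b eps_small by auto
  have u: "?u \<in> controls" using indicator_in_controls[of "1 - ?w"] w by simp
  have prof: "profile ?u x = a" if "x < 1 - ?w" for x
  proof -
    have "(LINT y|unit_lebesgue. indicator {..x} y * ?u y) = (LINT y|unit_lebesgue. 0)"
      using that by (intro Bochner_Integration.integral_cong) (auto simp: indicator_def)
    then show ?thesis by (simp add: profile_def)
  qed
  show "?u \<in> half_class (-1)"
    using u prof[of "1/2"] w a_less_b by (simp add: half_class_def)
  have "energy \<rho> ?u \<le> potential \<rho> (\<lambda>_. a) + 2 * (b - a) * measure lborel {1 - ?w..1}"
    using w a_less_b prof by (intro layer_energy_le u assms) (auto simp: indicator_def)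
  then show "energy \<rho> ?u \<le> potential \<rho> (\<lambda>_. a) + 2 * (b - a) * ?w" using w by simp
qed

lemma endpoint_weights: "q = (b - q) / (b - a) * a + (1 - (b - q) / (b - a)) * b"
  using a_less_b by (simp add: divide_simps) (simp add: algebra_simps)

text \<open>In the coordinate \<eta>, the weight of a, the chord of the potential integrand is
  affine with slope \<open>A x\<close>. Freezing \<eta> at its value \<theta> at x = 1/2 can only
  lower this chord, because \<eta> - \<theta> and A have the same sign. Both uses share this
  argument: \<kappa> = 0 compares the two constrained minima at extreme shifts, and \<kappa> = k/4
  rules out minimizers through the midpoint.\<close>

lemma energy_ge:
  fixes k \<gamma> \<kappa> :: real
  assumes u: "u \<in> controls" and \<rho>: "\<rho> \<in> unit_weights"
    and k: "0 \<le> k" "k \<le> 2 * \<gamma> * (b - a)"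
    and convex: "\<And>t. 0 \<le> t \<Longrightarrow> t \<le> 1 \<Longrightarrow>
       softplus (t * a + (1 - t) * b) \<le> t * softplus a + (1 - t) * softplus b - k * (t * (1 - t))"
    and left: "\<And>x. x < 1/2 \<Longrightarrow> balance a b + \<gamma> \<le> \<rho> x"
    and right: "\<And>x. 1/2 \<le> x \<Longrightarrow> \<rho> x \<le> balance a b - \<gamma>"
    and \<theta>: "profile u (1/2) = \<theta> * a + (1 - \<theta>) * b"
    and \<kappa>: "\<kappa> = 0 \<or> \<theta> = 1/2 \<and> \<kappa> = k / 4"
  shows "(LINT x|unit_lebesgue. binary_entropy (u x))
      + (\<theta> * potential \<rho> (\<lambda>_. a) + (1 - \<theta>) * potential \<rho> (\<lambda>_. b)) + \<kappa> \<le> energy \<rho> u"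
proof -
  have \<gamma>: "0 \<le> \<gamma> * (b - a)" using k by simp
  define A where "A x = (\<rho> x - balance a b) * (b - a)" for x
  have A: "(1 - \<rho> x) * a - softplus a = (1 - \<rho> x) * b - softplus b + A x" for x
    using a_less_b by (simp add: A_def balance_def field_simps)
  define \<eta> where "\<eta> x = (b - profile u x) / (b - a)" for x
  have prof: "profile u x = \<eta> x * a + (1 - \<eta> x) * b" for x
    unfolding \<eta>_def by (rule endpoint_weights)
  have \<eta>01: "0 \<le> \<eta> x" "\<eta> x \<le> 1" for x
    using profile_bounds[OF u, of x] a_less_b by (auto simp: \<eta>_def divide_simps)
  have \<eta>_half: "\<eta> (1/2) = \<theta>"
    using a_less_b by (simp add: \<eta>_def \<theta> divide_simps) (simp add: algebra_simps)
  have \<eta>_mono: "\<eta> y \<le> \<eta> x" if "x \<le> y" for x y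
    using profile_mono[OF u that] a_less_b by (simp add: \<eta>_def divide_right_mono)
  have int: "integrable unit_lebesgue (\<lambda>x. (1 - \<rho> x) * a - softplus a)"
    "integrable unit_lebesgue (\<lambda>x. (1 - \<rho> x) * b - softplus b)"
    using integrable_potential_const[OF \<rho>] a_less_b by auto
  have "(LINT x|unit_lebesgue. (\<theta> * ((1 - \<rho> x) * a - softplus a) + (1 - \<theta>) * ((1 - \<rho> x) * b - softplus b)) + \<kappa>)
      \<le> potential \<rho> (profile u)"
    unfolding potential_def
  proof (intro integral_unit_lebesgue_mono integrable_potential Bochner_Integration.integrable_add integrable_mult_right int u \<rho>)
    fix x :: real
    \<comment> \<open>\<open>softplus\<close> enters with a minus sign, so its strong convexity
      lifts the integrand above its chord between a and b.\<close>
    have conc: "(1 - \<rho> x) * b - softplus b + \<eta> x * A x + k * (\<eta> x * (1 - \<eta> x))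
        \<le> (1 - \<rho> x) * profile u x - softplus (profile u x)"
    proof -
      have "(1 - \<rho> x) * profile u x
          = \<eta> x * ((1 - \<rho> x) * a) + (1 - \<eta> x) * ((1 - \<rho> x) * b)"
        unfolding prof by (simp add: algebra_simps)
      moreover have "\<eta> x * ((1 - \<rho> x) * a) = \<eta> x * (((1 - \<rho> x) * b - softplus b + A x) + softplus a)"
        using A[of x] by simp
      ultimately show ?thesis
        using convex[OF \<eta>01, of x] unfolding prof[symmetric] by (simp add: algebra_simps)
    qed
    txt \<open>\<open>\<eta> - \<theta>\<close> and \<open>A\<close> change sign together at \<open>1/2\<close>, because \<open>\<eta>\<close> is antitone.\<close>
    have sign: "\<theta> * A x + \<gamma> * (b - a) * \<bar>\<eta> x - \<theta>\<bar> \<le> \<eta> x * A x"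
    proof (cases "x < 1/2")
      case True
      have "\<gamma> * (b - a) \<le> A x"
        unfolding A_def using left[OF True] a_less_b by (intro mult_right_mono) auto
      moreover have "\<theta> \<le> \<eta> x" using \<eta>_mono[of x "1/2"] True \<eta>_half by simp
      ultimately have "\<gamma> * (b - a) * (\<eta> x - \<theta>) \<le> A x * (\<eta> x - \<theta>)"
        by (intro mult_right_mono) auto
      then show ?thesis using \<open>\<theta> \<le> \<eta> x\<close> by (simp add: algebra_simps)
    next
      case False
      have "\<gamma> * (b - a) \<le> (balance a b - \<rho> x) * (b - a)"
        using right[of x] False a_less_b by (intro mult_right_mono) auto
      then have "\<gamma> * (b - a) \<le> - A x" by (simp add: A_def algebra_simps)
      moreover have "\<eta> x \<le> \<theta>" using \<eta>_mono[of "1/2" x] False \<eta>_half by simp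
      ultimately have "\<gamma> * (b - a) * (\<theta> - \<eta> x) \<le> - A x * (\<theta> - \<eta> x)"
        by (intro mult_right_mono) auto
      then show ?thesis using \<open>\<eta> x \<le> \<theta>\<close> by (simp add: algebra_simps)
    qed
    \<comment> \<open>At \<theta> = 1/2 the concavity term is k/4 - k h^2 with h = \<eta> - 1/2.
      Since |h| \<le> 1/2 gives h^2 \<le> |h| / 2, the bound on k lets the term in |h| absorb k
      h^2.\<close>
    have gap: "\<kappa> \<le> \<gamma> * (b - a) * \<bar>\<eta> x - \<theta>\<bar> + k * (\<eta> x * (1 - \<eta> x))"
    proof (cases "\<kappa> = 0")
      case True
      then show ?thesis using \<gamma> k \<eta>01[of x] by simp
    next
      case False
      then have "\<theta> = 1/2" "\<kappa> = k / 4" using \<kappa> by auto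
      define h where "h = \<eta> x - 1/2"
      have "\<bar>h\<bar> \<le> 1/2" unfolding h_def abs_le_iff using \<eta>01[of x] by auto
      then have "h\<^sup>2 \<le> \<bar>h\<bar> / 2"
        using mult_left_mono[of "\<bar>h\<bar>" "1/2" "\<bar>h\<bar>"] by (simp add: power2_eq_square)
      then have "k * h\<^sup>2 \<le> 2 * \<gamma> * (b - a) * (\<bar>h\<bar> / 2)" using k by (intro mult_mono) auto
      moreover have "k * (\<eta> x * (1 - \<eta> x)) = k / 4 - k * h\<^sup>2"
        by (simp add: h_def power2_eq_square algebra_simps)
      ultimately show ?thesis
        unfolding \<open>\<theta> = 1/2\<close> \<open>\<kappa> = k / 4\<close> h_def[symmetric] by simp
    qed
    have "\<theta> * ((1 - \<rho> x) * a - softplus a) + (1 - \<theta>) * ((1 - \<rho> x) * b - softplus b)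
        = (1 - \<rho> x) * b - softplus b + \<theta> * A x"
      unfolding A by (simp add: algebra_simps)
    then show "\<theta> * ((1 - \<rho> x) * a - softplus a) + (1 - \<theta>) * ((1 - \<rho> x) * b - softplus b) + \<kappa>
        \<le> (1 - \<rho> x) * profile u x - softplus (profile u x)"
      using conc sign gap by linarith
  qed simp
  moreover have "(LINT x|unit_lebesgue. (\<theta> * ((1 - \<rho> x) * a - softplus a) + (1 - \<theta>) * ((1 - \<rho> x) * b - softplus b)) + \<kappa>)
     = \<theta> * potential \<rho> (\<lambda>_. a) + (1 - \<theta>) * potential \<rho> (\<lambda>_. b) + \<kappa>"
    unfolding potential_def using int
    by (subst Bochner_Integration.integral_add) simp_all
  ultimately show ?thesis unfolding energy_split[OF u \<rho>] by linarith
qed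

section \<open>Correspondence between controls and profiles of finite functional\<close>

lemma is_increment_measure_profile:
  assumes "u \<in> controls"
  shows "is_increment_measure a b (restrict (profile u) {0..1})
    (density unit_lebesgue (\<lambda>x. ennreal (u x / \<epsilon>)))" (is "is_increment_measure a b _ ?\<mu>")
proof -
  have [measurable]: "u \<in> borel_measurable unit_lebesgue" using assms controlsD by auto
  have nonneg: "0 \<le> u x / \<epsilon>" for x using controlsD(2)[OF assms] eps_pos by simp
  have em: "emeasure ?\<mu> A = ennreal ((LINT y|unit_lebesgue. indicator A y * u y) / \<epsilon>)"
    if "A \<in> sets borel" "A \<subseteq> {0..1}" for A
  proof -
    have A: "A \<in> sets unit_lebesgue"
      using that by (auto simp: sets_unit_lebesgue sets_restrict_space_iff)
    have "emeasure ?\<mu> A = (\<integral>\<^sup>+x. ennreal (u x / \<epsilon>) * indicator A x \<partial>unit_lebesgue)"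
      by (intro emeasure_density A) measurable
    also have "\<dots> = (\<integral>\<^sup>+x. ennreal (indicator A x * u x / \<epsilon>) \<partial>unit_lebesgue)"
      by (intro nn_integral_cong) (auto simp: indicator_def)
    also have "\<dots> = ennreal (LINT x|unit_lebesgue. indicator A x * u x / \<epsilon>)"
      using nonneg that assms eps_pos controlsD(2)[OF assms]
      by (intro nn_integral_eq_integral integrable_divide integrable_control_mult) auto
    finally show ?thesis by simp
  qed
  show ?thesis
    unfolding is_increment_measure_def
  proof (intro conjI ballI)
    show "sets ?\<mu> = sets (restrict_space borel {0..1})" by (simp add: sets_unit_lebesgue)
    have "(LINT y|unit_lebesgue. indicator {0..1} y * u y) = (LINT y|unit_lebesgue. u y)"
      by (intro Bochner_Integration.integral_cong) auto
    then show "emeasure ?\<mu> (space ?\<mu>) = ennreal (b - a)"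
      using em[of "{0..1}"] eps_pos by (simp add: controlsD(4)[OF assms])
    fix x :: real assume x: "x \<in> {0..1}"
    have "0 \<le> (LINT y|unit_lebesgue. indicator {0..x} y * u y)"
      using controlsD(2)[OF assms] by (intro integral_nonneg_AE) auto
    then have "measure ?\<mu> {0..x} = (LINT y|unit_lebesgue. indicator {0..x} y * u y) / \<epsilon>"
      using em[of "{0..x}"] x eps_pos by (simp add: measure_def)
    also have "(LINT y|unit_lebesgue. indicator {0..x} y * u y) = (LINT y|unit_lebesgue. indicator {..x} y * u y)"
      by (intro Bochner_Integration.integral_cong) (auto simp: indicator_def)
    finally show "restrict (profile u) {0..1} x = a + measure ?\<mu> {0..x}"
      using x by (simp add: profile_def)
  qed
qed

lemma profile_in_profiles:
  "u \<in> controls \<Longrightarrow> restrict (profile u) {0..1} \<in> profiles a b"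
  using is_increment_measure_profile by (auto simp: profiles_def)

text \<open>The derivative of the increment measure is u/\<epsilon> only almost everywhere, so the
  two integrands are compared up to a null set.\<close>

lemma G_functional_profile:
  assumes u: "u \<in> controls" and \<rho>: "\<rho> \<in> unit_weights"
  shows "G_functional a b \<epsilon> \<rho> (restrict (profile u) {0..1})
     = ereal ((LINT x|unit_lebesgue. binary_entropy (\<rho> x)) + energy \<rho> u)"
proof -
  have [measurable]: "u \<in> borel_measurable unit_lebesgue" using u controlsD by auto
  have [measurable]: "\<rho> \<in> borel_measurable unit_lebesgue" using \<rho> by (simp add: unit_weights_def)
  have [measurable]: "profile u \<in> borel_measurable unit_lebesgue"
    using u by (intro measurable_unit_lebesgue measurable_profile)
  have \<rho>01: "0 \<le> \<rho> x" "\<rho> x \<le> 1" for x using \<rho> by (auto simp: unit_weights_def)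
  note u01 = controlsD(2,3)[OF u]
  let ?f = "\<lambda>x. ennreal (u x / \<epsilon>)"
  let ?\<mu> = "density unit_lebesgue ?f"
  have inc: "increment_measure a b (restrict (profile u) {0..1}) = ?\<mu>"
    by (intro increment_measure_eq is_increment_measure_profile u)
  have ac: "absolutely_continuous unit_lebesgue ?\<mu>"
    by (intro absolutely_continuousI_density) measurable
  have rn: "AE x in unit_lebesgue. ?f x = RN_deriv unit_lebesgue ?\<mu> x"
    by (intro unit_lebesgue.RN_deriv_unique) auto
  then have bnd: "AE x in unit_lebesgue. RN_deriv unit_lebesgue ?\<mu> x \<le> ennreal (1 / \<epsilon>)"
  proof eventually_elim
    case (elim x)
    have "u x / \<epsilon> \<le> 1 / \<epsilon>" using u01(2) eps_pos by (intro divide_right_mono) auto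
    then show ?case unfolding elim[symmetric] by (rule ennreal_leI)
  qed
  have ent: "integrable unit_lebesgue (\<lambda>x. binary_entropy (\<rho> x))"
  proof (rule integrable_unit_lebesgue[where B=1])
    show "\<bar>binary_entropy (\<rho> x)\<bar> \<le> 1" for x
      using binary_entropy_nonpos[OF \<rho>01] binary_entropy_ge_minus_one[OF \<rho>01, of x] by (simp add: abs_le_iff)
  qed measurable
  have "(LINT x|unit_lebesgue. real_of_ereal (entropy (\<rho> x))
        + real_of_ereal (entropy (\<epsilon> * enn2real (RN_deriv unit_lebesgue ?\<mu> x)))
        + (1 - \<rho> x) * restrict (profile u) {0..1} x - ln (1 + exp (restrict (profile u) {0..1} x)))
    = (LINT x|unit_lebesgue. binary_entropy (\<rho> x)
        + (binary_entropy (u x) + ((1 - \<rho> x) * profile u x - softplus (profile u x))))"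
  proof (rule integral_cong_AE)
    show "AE x in unit_lebesgue. real_of_ereal (entropy (\<rho> x))
        + real_of_ereal (entropy (\<epsilon> * enn2real (RN_deriv unit_lebesgue ?\<mu> x)))
        + (1 - \<rho> x) * restrict (profile u) {0..1} x - ln (1 + exp (restrict (profile u) {0..1} x))
       = binary_entropy (\<rho> x) + (binary_entropy (u x) + ((1 - \<rho> x) * profile u x - softplus (profile u x)))"
      using rn AE_space
    proof eventually_elim
      case (elim x)
      have "\<epsilon> * enn2real (RN_deriv unit_lebesgue ?\<mu> x) = u x"
        unfolding elim(1)[symmetric] using u01 eps_pos by simp
      then show ?case using elim(2) by (simp add: entropy_eq \<rho>01 u01 softplus_def)
    qed
  next
    have [measurable]: "restrict (profile u) {0..1} \<in> borel_measurable unit_lebesgue"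
    proof -
      have "restrict (profile u) {0..1} \<in> borel_measurable unit_lebesgue
          \<longleftrightarrow> profile u \<in> borel_measurable unit_lebesgue"
        by (intro measurable_cong) simp
      then show ?thesis by simp
    qed
    have [measurable]: "(\<lambda>x. real_of_ereal (entropy x)) \<in> borel_measurable borel"
    proof -
      have "real_of_ereal (entropy x) = (if 0 \<le> x \<and> x \<le> 1 then binary_entropy x else 0)" for x
        by (simp add: entropy_def binary_entropy_def)
      then show ?thesis by simp
    qed
    show "(\<lambda>x. real_of_ereal (entropy (\<rho> x))
        + real_of_ereal (entropy (\<epsilon> * enn2real (RN_deriv unit_lebesgue ?\<mu> x)))
        + (1 - \<rho> x) * restrict (profile u) {0..1} x - ln (1 + exp (restrict (profile u) {0..1} x)))
        \<in> borel_measurable unit_lebesgue" by measurable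
    show "(\<lambda>x. binary_entropy (\<rho> x) + (binary_entropy (u x) + ((1 - \<rho> x) * profile u x - softplus (profile u x))))
        \<in> borel_measurable unit_lebesgue" by measurable
  qed
  also have "\<dots> = (LINT x|unit_lebesgue. binary_entropy (\<rho> x))
      + (LINT x|unit_lebesgue. binary_entropy (u x) + ((1 - \<rho> x) * profile u x - softplus (profile u x)))"
    by (intro Bochner_Integration.integral_add Bochner_Integration.integrable_add ent
        integrable_entropy integrable_potential u \<rho>)
  also have "\<dots> = (LINT x|unit_lebesgue. binary_entropy (\<rho> x)) + energy \<rho> u"
    unfolding energy_def by (simp add: add_diff_eq)
  finally show ?thesis
    unfolding G_functional_def Let_def inc using ac bnd by simp
qed

text \<open>Absolute continuity and the density bound recover the control as \<epsilon> times the
  Radon-Nikodym derivative; minimizing over \<open>controls\<close> therefore misses no competitor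
  of finite value.\<close>

lemma finite_G_functionalE:
  assumes "\<psi> \<in> profiles a b" "G_functional a b \<epsilon> \<rho> \<psi> \<noteq> \<infinity>"
  obtains u where "u \<in> controls" "\<psi> = restrict (profile u) {0..1}"
proof -
  obtain \<mu> where \<mu>: "is_increment_measure a b \<psi> \<mu>" and \<psi>_ext: "\<psi> \<in> extensional {0..1}"
    using assms(1) by (auto simp: profiles_def)
  note inc = increment_measure_eq[OF \<mu>]
  have ac: "absolutely_continuous unit_lebesgue \<mu>"
    and bnd: "AE x in unit_lebesgue. RN_deriv unit_lebesgue \<mu> x \<le> ennreal (1 / \<epsilon>)"
    using assms(2) unfolding G_functional_def Let_def inc by (auto split: if_splits)
  define D where "D = RN_deriv unit_lebesgue \<mu>"
  have D [measurable]: "D \<in> borel_measurable unit_lebesgue" by (simp add: D_def)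
  have sets: "sets \<mu> = sets unit_lebesgue"
    using \<mu> by (simp add: is_increment_measure_def sets_unit_lebesgue)
  have dens: "density unit_lebesgue D = \<mu>"
    unfolding D_def using ac sets by (rule unit_lebesgue.density_RN_deriv)
  \<comment> \<open>The derivative is at most 1/\<epsilon> only almost everywhere; the minimum with
    1 changes a null set and gives the bound at every point.\<close>
  define u where "u x = min 1 (\<epsilon> * enn2real (D x))" for x
  have [measurable]: "u \<in> borel_measurable unit_lebesgue" unfolding u_def by measurable
  have u01: "0 \<le> u x" "u x \<le> 1" for x using eps_pos by (auto simp: u_def)
  have uD: "AE x in unit_lebesgue. D x = ennreal (u x / \<epsilon>)"
    using bnd unfolding D_def[symmetric]
  proof eventually_elim
    case (elim x)
    then have fin: "D x < top" by (simp add: le_less_trans)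
    have "enn2real (D x) \<le> 1 / \<epsilon>"
      using elim eps_pos by (intro enn2real_leI) auto
    then have "\<epsilon> * enn2real (D x) \<le> 1" using eps_pos by (simp add: field_simps)
    then have "u x / \<epsilon> = enn2real (D x)" using eps_pos by (simp add: u_def)
    then show ?case using fin by simp
  qed
  have em: "emeasure \<mu> A = ennreal ((LINT y|unit_lebesgue. indicator A y * u y) / \<epsilon>)"
    if "A \<in> sets borel" "A \<subseteq> {0..1}" for A
  proof -
    have A [measurable]: "A \<in> sets unit_lebesgue"
      using that by (auto simp: sets_unit_lebesgue sets_restrict_space_iff)
    have "emeasure \<mu> A = (\<integral>\<^sup>+x. D x * indicator A x \<partial>unit_lebesgue)"
      unfolding dens[symmetric] by (intro emeasure_density A) measurable
    also have "\<dots> = (\<integral>\<^sup>+x. ennreal (indicator A x * u x / \<epsilon>) \<partial>unit_lebesgue)"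
      using uD by (intro nn_integral_cong_AE, eventually_elim) (auto simp: indicator_def)
    also have "\<dots> = ennreal (LINT x|unit_lebesgue. indicator A x * u x / \<epsilon>)"
    proof (intro nn_integral_eq_integral integrable_divide)
      show "integrable unit_lebesgue (\<lambda>x. indicator A x * u x)"
        using u01 by (intro integrable_unit_lebesgue[where B=1]) (auto simp: indicator_def)
    qed (use u01 eps_pos in auto)
    finally show ?thesis by simp
  qed
  have nn: "0 \<le> (LINT y|unit_lebesgue. indicator A y * u y) / \<epsilon>" for A
    using u01 eps_pos by (intro divide_nonneg_pos integral_nonneg_AE) auto
  have "space \<mu> = {0..1}" using sets_eq_imp_space_eq[OF sets] by simp
  then have "ennreal (b - a) = ennreal ((LINT y|unit_lebesgue. indicator {0..1} y * u y) / \<epsilon>)"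
    using \<mu> em[of "{0..1}"] by (simp add: is_increment_measure_def)
  then have "b - a = (LINT y|unit_lebesgue. indicator {0..1} y * u y) / \<epsilon>"
    using nn a_less_b by simp
  moreover have "(LINT y|unit_lebesgue. indicator {0..1} y * u y) = (LINT y|unit_lebesgue. u y)"
    by (intro Bochner_Integration.integral_cong) auto
  ultimately have "(LINT y|unit_lebesgue. u y) = \<epsilon> * (b - a)"
    using eps_pos by (simp add: field_simps)
  then have u: "u \<in> controls" using u01 by (simp add: controls_def)
  have "\<psi> x = restrict (profile u) {0..1} x" for x
  proof (cases "x \<in> {0..1}")
    case True
    have "measure \<mu> {0..x} = (LINT y|unit_lebesgue. indicator {0..x} y * u y) / \<epsilon>"
      using em[of "{0..x}"] nn True by (simp add: measure_def)
    also have "(LINT y|unit_lebesgue. indicator {0..x} y * u y) = (LINT y|unit_lebesgue. indicator {..x} y * u y)"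
      by (intro Bochner_Integration.integral_cong) (auto simp: indicator_def)
    finally show ?thesis
      using True \<mu> by (simp add: is_increment_measure_def profile_def)
  next
    case False
    then show ?thesis using extensional_arb[OF \<psi>_ext False] by (simp only: restrict_apply if_False)
  qed
  then have "\<psi> = restrict (profile u) {0..1}" by (rule ext)
  then show thesis by (rule that[OF u])
qed

lemma minimizer_in_G_minimizers:
  assumes u: "u \<in> controls" and \<rho>: "\<rho> \<in> unit_weights"
    and min: "\<And>v. v \<in> controls \<Longrightarrow> energy \<rho> u \<le> energy \<rho> v"
  shows "restrict (profile u) {0..1} \<in> G_minimizers a b \<epsilon> \<rho>"
  unfolding G_minimizers_def
proof (intro CollectI conjI ballI)
  show "restrict (profile u) {0..1} \<in> profiles a b" using u by (rule profile_in_profiles)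
  fix \<psi> assume \<psi>: "\<psi> \<in> profiles a b"
  show "G_functional a b \<epsilon> \<rho> (restrict (profile u) {0..1}) \<le> G_functional a b \<epsilon> \<rho> \<psi>"
  proof (cases "G_functional a b \<epsilon> \<rho> \<psi> = \<infinity>")
    case False
    then obtain v where "v \<in> controls" "\<psi> = restrict (profile v) {0..1}"
      using finite_G_functionalE[OF \<psi>] by blast
    then show ?thesis using min u \<rho> by (simp add: G_functional_profile)
  qed simp
qed

end

section \<open>Balancing the two constrained minima\<close>

lemma step_density_integral:
  "(LINT x|unit_lebesgue. step_density c \<delta> \<tau> x) = c + \<tau>"
proof -
  have "(LINT x|unit_lebesgue. step_density c \<delta> \<tau> x)
      = (LINT x|unit_lebesgue. (c - \<delta> + \<tau>) + 2 * \<delta> * indicator {0..<1/2} x)"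
    by (intro Bochner_Integration.integral_cong) (auto simp: step_density_def)
  also have "\<dots> = (c - \<delta> + \<tau>) + 2 * \<delta> * (LINT x|unit_lebesgue. indicator {0..<1/2} x)"
  proof -
    have "integrable unit_lebesgue (indicator {0..<1/2::real} :: real \<Rightarrow> real)"
      by (intro integrable_unit_lebesgue[where B=1] measurable_unit_lebesgue) (auto simp: indicator_def)
    then show ?thesis by (subst Bochner_Integration.integral_add) simp_all
  qed
  also have "(LINT x|unit_lebesgue. indicator {0..<1/2} x :: real) = 1/2"
    by (subst integral_indicator_unit_lebesgue) auto
  finally show ?thesis by simp
qed

context profile_problem
begin

lemma step_density_in_unit_weights:
  assumes "\<bar>\<tau>\<bar> \<le> \<delta> / 2" "2 * \<delta> \<le> c" "2 * \<delta> \<le> 1 - c"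
  shows "step_density c \<delta> \<tau> \<in> unit_weights"
  using assms unfolding unit_weights_def step_density_def abs_le_iff
  by (auto intro!: measurable_unit_lebesgue)

lemma profile_abs_le: "u \<in> controls \<Longrightarrow> \<bar>profile u x\<bar> \<le> \<bar>a\<bar> + \<bar>b\<bar>"
  using profile_bounds[of u x] by linarith

lemma mean_profile_bound:
  assumes "u \<in> controls"
  shows "\<bar>LINT x|unit_lebesgue. profile u x\<bar> \<le> \<bar>a\<bar> + \<bar>b\<bar>"
proof -
  have "\<bar>LINT x|unit_lebesgue. profile u x\<bar> \<le> (LINT x|unit_lebesgue. \<bar>profile u x\<bar>)"
    by (rule integral_abs_bound)
  also have "\<dots> \<le> (LINT x|unit_lebesgue. \<bar>a\<bar> + \<bar>b\<bar>)"
    using profile_abs_le[OF assms] by (intro integral_unit_lebesgue_mono integrable_unit_lebesgue[where B="\<bar>a\<bar> + \<bar>b\<bar>"]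
        borel_measurable_abs measurable_unit_lebesgue measurable_profile assms) auto
  finally show ?thesis by simp
qed

text \<open>\<rho> enters linearly through the term -\<rho> \<phi>, so the energy is affine in the
  shift with slope minus the mean of the profile. This slope is bounded uniformly in u, which makes
  the constrained minima Lipschitz in \<tau>.\<close>

lemma energy_step_density:
  assumes "u \<in> controls" "step_density c \<delta> \<tau> \<in> unit_weights" "step_density c \<delta> \<tau>' \<in> unit_weights"
  shows "energy (step_density c \<delta> \<tau>) u
    = energy (step_density c \<delta> \<tau>') u + (\<tau>' - \<tau>) * (LINT x|unit_lebesgue. profile u x)"
proof -
  have prof: "integrable unit_lebesgue (profile u)"
    by (intro integrable_unit_lebesgue[OF _ profile_abs_le] measurable_unit_lebesgue measurable_profile assms)
  have "potential (step_density c \<delta> \<tau>) (profile u) = (LINT x|unit_lebesgue.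
      ((1 - step_density c \<delta> \<tau>' x) * profile u x - softplus (profile u x)) + (\<tau>' - \<tau>) * profile u x)"
    unfolding potential_def
    by (intro Bochner_Integration.integral_cong) (auto simp: step_density_def algebra_simps)
  also have "\<dots> = potential (step_density c \<delta> \<tau>') (profile u) + (\<tau>' - \<tau>) * (LINT x|unit_lebesgue. profile u x)"
    unfolding potential_def using prof integrable_potential[OF assms(1,3)]
    by (subst Bochner_Integration.integral_add) simp_all
  finally show ?thesis
    unfolding energy_split[OF assms(1,2)] energy_split[OF assms(1,3)] by simp
qed

text \<open>Constant profiles see only the mean of \<rho>, where the steps \<delta> and -\<delta>
  cancel, and \<open>balance\<close> equalizes the two costs at \<tau> = 0.\<close>

lemma potential_endpoint_diff:
  assumes "step_density (balance a b) \<delta> \<tau> \<in> unit_weights"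
  shows "potential (step_density (balance a b) \<delta> \<tau>) (\<lambda>_. a)
    = potential (step_density (balance a b) \<delta> \<tau>) (\<lambda>_. b) + (b - a) * \<tau>"
proof -
  let ?\<rho> = "step_density (balance a b) \<delta> \<tau>"
  have \<rho>: "integrable unit_lebesgue ?\<rho>"
    using assms by (intro integrable_unit_lebesgue[where B=1]) (auto simp: unit_weights_def)
  have *: "potential ?\<rho> (\<lambda>_. c) = (1 - (balance a b + \<tau>)) * c - softplus c" for c
  proof -
    have "potential ?\<rho> (\<lambda>_. c) = (1 - (LINT x|unit_lebesgue. ?\<rho> x)) * c - softplus c"
      unfolding potential_def using \<rho> by simp
    then show ?thesis by (simp add: step_density_integral)
  qed
  show ?thesis
    unfolding * using a_less_b by (simp add: balance_def field_simps)
qed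

text \<open>The difference of the two constrained minima is continuous in \<tau> and changes sign
  between -\<delta>/2 and \<delta>/2. At a zero both constrained minimizers are global, and the
  margin k/4 keeps them apart.\<close>

lemma two_minimizers:
  fixes k \<delta> p :: real
  assumes k: "0 \<le> k" "k \<le> \<delta> * (b - a)"
    and convex: "\<And>t. 0 \<le> t \<Longrightarrow> t \<le> 1 \<Longrightarrow>
       softplus (t * a + (1 - t) * b) \<le> t * softplus a + (1 - t) * softplus b - k * (t * (1 - t))"
    and \<delta>: "0 < \<delta>" "2 * \<delta> \<le> balance a b" "2 * \<delta> \<le> 1 - balance a b"
    and p: "0 < p" "p < 1"
    and small: "2 * (b - a) * (\<epsilon> * (b - a)) - (\<epsilon> * (b - a) * ln p + ln (1 - p)) < k / 4"
  obtains \<rho> u v where "\<rho> \<in> unit_weights" "u \<in> controls" "v \<in> controls"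
    "profile u (1/2) \<noteq> profile v (1/2)"
    "\<And>w. w \<in> controls \<Longrightarrow> energy \<rho> u \<le> energy \<rho> w"
    "\<And>w. w \<in> controls \<Longrightarrow> energy \<rho> v \<le> energy \<rho> w"
proof -
  define \<rho> where "\<rho> \<tau> = step_density (balance a b) \<delta> \<tau>" for \<tau>
  define T where "T = {- (\<delta> / 2)..\<delta> / 2}"
  have \<rho>: "\<rho> \<tau> \<in> unit_weights" if "\<tau> \<in> T" for \<tau>
    unfolding \<rho>_def using that \<delta> by (intro step_density_in_unit_weights) (auto simp: T_def abs_le_iff)
  \<comment> \<open>\<open>e\<close> bounds the excess of a transition layer over its constant
    profile, \<open>d\<close> the amount by which the entropy can lower the energy;
    \<open>small\<close> keeps their sum below the margin.\<close>
  define e where "e = 2 * (b - a) * (\<epsilon> * (b - a))"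
  define d where "d = - (\<epsilon> * (b - a) * ln p + ln (1 - p))"
  define P where "P c \<tau> = potential (\<rho> \<tau>) (\<lambda>_. c)" for c \<tau>
  have ed: "e + d < k / 4" using small by (simp add: e_def d_def)
  have Pab: "P a \<tau> = P b \<tau> + (b - a) * \<tau>" if "\<tau> \<in> T" for \<tau>
    unfolding P_def \<rho>_def using \<rho>[OF that] by (intro potential_endpoint_diff) (simp add: \<rho>_def)
  have half: "half_class \<sigma> \<subseteq> controls" for \<sigma> by (auto simp: half_class_def)
  have lower: "\<theta> * P a \<tau> + (1 - \<theta>) * P b \<tau> + \<kappa> - d \<le> energy (\<rho> \<tau>) u"
    if "\<tau> \<in> T" "u \<in> controls" "profile u (1/2) = \<theta> * a + (1 - \<theta>) * b"
      "\<kappa> = 0 \<or> \<theta> = 1/2 \<and> \<kappa> = k / 4" for \<tau> u \<theta> \<kappa>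
  proof -
    have "(LINT x|unit_lebesgue. binary_entropy (u x)) + (\<theta> * P a \<tau> + (1 - \<theta>) * P b \<tau>) + \<kappa> \<le> energy (\<rho> \<tau>) u"
      unfolding P_def
    proof (rule energy_ge[OF that(2) \<rho>[OF that(1)] k(1) _ convex _ _ that(3,4), of "\<delta> / 2"])
      show "k \<le> 2 * (\<delta> / 2) * (b - a)" using k by simp
    qed (use that(1) in \<open>auto simp: \<rho>_def step_density_def T_def\<close>)
    with entropy_integral_ge[OF that(2) p] show ?thesis by (simp add: d_def)
  qed
  have early: "\<exists>u\<in>half_class 1. energy (\<rho> \<tau>) u \<le> P b \<tau> + e" if "\<tau> \<in> T" for \<tau>
    using early_layer[OF \<rho>[OF that]] unfolding P_def e_def by blast
  have late: "\<exists>u\<in>half_class (-1). energy (\<rho> \<tau>) u \<le> P a \<tau> + e" if "\<tau> \<in> T" for \<tau>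
    using late_layer[OF \<rho>[OF that]] unfolding P_def e_def by blast

  have T0: "- (\<delta> / 2) \<in> T" "\<delta> / 2 \<in> T" using \<delta> by (auto simp: T_def)
  have ne: "half_class 1 \<noteq> {}" "half_class (-1) \<noteq> {}"
    using early[OF T0(1)] late[OF T0(1)] by auto
  have choice: "\<exists>u. \<forall>\<tau>\<in>T. u \<tau> \<in> half_class \<sigma> \<and> (\<forall>w\<in>half_class \<sigma>. energy (\<rho> \<tau>) (u \<tau>) \<le> energy (\<rho> \<tau>) w)"
    if "half_class \<sigma> \<noteq> {}" for \<sigma>
  proof (intro bchoice ballI)
    fix \<tau> assume \<tau>: "\<tau> \<in> T"
    show "\<exists>u. u \<in> half_class \<sigma> \<and> (\<forall>w\<in>half_class \<sigma>. energy (\<rho> \<tau>) u \<le> energy (\<rho> \<tau>) w)"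
      by (rule exists_minimizer[OF \<rho>[OF \<tau>] that]) blast
  qed
  obtain u where u: "\<And>\<tau>. \<tau> \<in> T \<Longrightarrow> u \<tau> \<in> half_class 1"
      "\<And>\<tau> w. \<tau> \<in> T \<Longrightarrow> w \<in> half_class 1 \<Longrightarrow> energy (\<rho> \<tau>) (u \<tau>) \<le> energy (\<rho> \<tau>) w"
    using choice[OF ne(1)] by blast
  obtain v where v: "\<And>\<tau>. \<tau> \<in> T \<Longrightarrow> v \<tau> \<in> half_class (-1)"
      "\<And>\<tau> w. \<tau> \<in> T \<Longrightarrow> w \<in> half_class (-1) \<Longrightarrow> energy (\<rho> \<tau>) (v \<tau>) \<le> energy (\<rho> \<tau>) w"
    using choice[OF ne(2)] by blast
  define B where "B = \<bar>a\<bar> + \<bar>b\<bar>"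
  \<comment> \<open>The chosen minimizers may jump with \<tau>, but the minimal value does not: the
    minimizer at t is a competitor at s, and exchanging s and t gives the Lipschitz bound.\<close>
  have cont: "continuous_on T (\<lambda>\<tau>. energy (\<rho> \<tau>) (z \<tau>))"
    if z: "\<And>\<tau>. \<tau> \<in> T \<Longrightarrow> z \<tau> \<in> K" "K \<subseteq> controls"
      "\<And>\<tau> w. \<tau> \<in> T \<Longrightarrow> w \<in> K \<Longrightarrow> energy (\<rho> \<tau>) (z \<tau>) \<le> energy (\<rho> \<tau>) w" for z K
  proof (rule lipschitz_on_continuous_on[of B], rule lipschitz_onI)
    have *: "energy (\<rho> s) (z s) \<le> energy (\<rho> t) (z t) + B * \<bar>s - t\<bar>" if st: "s \<in> T" "t \<in> T" for s t
    proof -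
      have zt: "z t \<in> controls" using z st by blast
      have "energy (\<rho> s) (z s) \<le> energy (\<rho> s) (z t)" using z st by blast
      also have "\<dots> = energy (\<rho> t) (z t) + (t - s) * (LINT x|unit_lebesgue. profile (z t) x)"
        unfolding \<rho>_def using \<rho>[OF st(1)] \<rho>[OF st(2)] zt by (intro energy_step_density) (auto simp: \<rho>_def)
      also have "(t - s) * (LINT x|unit_lebesgue. profile (z t) x) \<le> \<bar>t - s\<bar> * B"
      proof -
        have "(t - s) * (LINT x|unit_lebesgue. profile (z t) x)
            \<le> \<bar>t - s\<bar> * \<bar>LINT x|unit_lebesgue. profile (z t) x\<bar>"
          unfolding abs_mult[symmetric] by (rule abs_ge_self)
        also have "\<dots> \<le> \<bar>t - s\<bar> * B"
          unfolding B_def by (intro mult_left_mono mean_profile_bound zt) simp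
        finally show ?thesis .
      qed
      finally show ?thesis by (simp add: abs_minus_commute mult.commute)
    qed
    show "0 \<le> B" by (simp add: B_def)
    show "dist (energy (\<rho> s) (z s)) (energy (\<rho> t) (z t)) \<le> B * dist s t" if "s \<in> T" "t \<in> T" for s t
      using *[OF that] *[OF that(2,1)] by (simp add: dist_real_def abs_le_iff abs_minus_commute)
  qed
  have diff_cont: "continuous_on T (\<lambda>\<tau>. energy (\<rho> \<tau>) (v \<tau>) - energy (\<rho> \<tau>) (u \<tau>))"
    by (intro continuous_on_diff cont[OF v(1) half v(2)] cont[OF u(1) half u(2)])
  \<comment> \<open>Here the constant b is cheaper than a by (b - a) \<delta>/2. A profile at or
    below the midpoint has \<theta> \<ge> 1/2, hence pays at least (b - a) \<delta>/4 \<ge> k/4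
    above \<open>P b\<close>, up to d, and loses to the early layer.\<close>
  have diff_right: "energy (\<rho> (\<delta> / 2)) (v (\<delta> / 2)) - energy (\<rho> (\<delta> / 2)) (u (\<delta> / 2)) \<ge> 0"
  proof -
    let ?\<tau> = "\<delta> / 2"
    define \<theta> where "\<theta> = (b - profile (v ?\<tau>) (1/2)) / (b - a)"
    have vc: "v ?\<tau> \<in> controls" using v(1)[OF T0(2)] half by blast
    have "profile (v ?\<tau>) (1/2) \<le> (a + b) / 2"
      using v(1)[OF T0(2)] by (simp add: half_class_def)
    then have "1/2 \<le> \<theta>"
      unfolding \<theta>_def using a_less_b by (simp add: pos_le_divide_eq)
    moreover have "profile (v ?\<tau>) (1/2) = \<theta> * a + (1 - \<theta>) * b"
      unfolding \<theta>_def by (rule endpoint_weights)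
    ultimately have \<theta>: "1/2 \<le> \<theta>" "profile (v ?\<tau>) (1/2) = \<theta> * a + (1 - \<theta>) * b" by auto
    have "\<theta> * P a ?\<tau> + (1 - \<theta>) * P b ?\<tau> + 0 - d \<le> energy (\<rho> ?\<tau>) (v ?\<tau>)"
      by (rule lower[OF T0(2) vc \<theta>(2)]) simp
    moreover have "\<theta> * P a ?\<tau> + (1 - \<theta>) * P b ?\<tau> = P b ?\<tau> + \<theta> * ((b - a) * ?\<tau>)"
      unfolding Pab[OF T0(2)] by (simp add: algebra_simps)
    moreover have "1/2 * ((b - a) * ?\<tau>) \<le> \<theta> * ((b - a) * ?\<tau>)"
      using \<theta>(1) a_less_b \<delta> by (intro mult_right_mono) auto
    moreover have "k / 4 \<le> 1/2 * ((b - a) * ?\<tau>)" using k by (simp add: mult.commute)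
    moreover obtain w where "w \<in> half_class 1" "energy (\<rho> ?\<tau>) w \<le> P b ?\<tau> + e"
      using early[OF T0(2)] by blast
    ultimately show ?thesis using u(2)[OF T0(2), of w] ed by linarith
  qed
  \<comment> \<open>The same comparison with a and b exchanged: a profile at or above the midpoint
    loses to the late layer.\<close>
  have diff_left: "energy (\<rho> (- (\<delta> / 2))) (v (- (\<delta> / 2))) - energy (\<rho> (- (\<delta> / 2))) (u (- (\<delta> / 2))) \<le> 0"
  proof -
    let ?\<tau> = "- (\<delta> / 2)"
    define \<theta> where "\<theta> = (b - profile (u ?\<tau>) (1/2)) / (b - a)"
    have uc: "u ?\<tau> \<in> controls" using u(1)[OF T0(1)] half by blast
    have "(a + b) / 2 \<le> profile (u ?\<tau>) (1/2)"
      using u(1)[OF T0(1)] by (simp add: half_class_def)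
    then have "\<theta> \<le> 1/2"
      unfolding \<theta>_def using a_less_b by (simp add: pos_divide_le_eq)
    moreover have "profile (u ?\<tau>) (1/2) = \<theta> * a + (1 - \<theta>) * b"
      unfolding \<theta>_def by (rule endpoint_weights)
    ultimately have \<theta>: "\<theta> \<le> 1/2" "profile (u ?\<tau>) (1/2) = \<theta> * a + (1 - \<theta>) * b" by auto
    have "\<theta> * P a ?\<tau> + (1 - \<theta>) * P b ?\<tau> + 0 - d \<le> energy (\<rho> ?\<tau>) (u ?\<tau>)"
      by (rule lower[OF T0(1) uc \<theta>(2)]) simp
    moreover have "\<theta> * P a ?\<tau> + (1 - \<theta>) * P b ?\<tau> = P a ?\<tau> + (1 - \<theta>) * ((b - a) * (\<delta> / 2))"
      unfolding Pab[OF T0(1)] by (simp add: field_simps)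
    moreover have "1/2 * ((b - a) * (\<delta> / 2)) \<le> (1 - \<theta>) * ((b - a) * (\<delta> / 2))"
      using \<theta>(1) a_less_b \<delta> by (intro mult_right_mono) auto
    moreover have "k / 4 \<le> 1/2 * ((b - a) * (\<delta> / 2))" using k by (simp add: mult.commute)
    moreover obtain w where "w \<in> half_class (-1)" "energy (\<rho> ?\<tau>) w \<le> P a ?\<tau> + e"
      using late[OF T0(1)] by blast
    ultimately show ?thesis using v(2)[OF T0(1), of w] ed by linarith
  qed
  have "\<exists>\<tau>\<ge>- (\<delta> / 2). \<tau> \<le> \<delta> / 2 \<and> energy (\<rho> \<tau>) (v \<tau>) - energy (\<rho> \<tau>) (u \<tau>) = 0"
    using diff_cont \<delta>(1) unfolding T_def by (intro IVT' diff_left diff_right) auto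
  then obtain \<tau> where \<tau>: "\<tau> \<in> T" "energy (\<rho> \<tau>) (v \<tau>) - energy (\<rho> \<tau>) (u \<tau>) = 0"
    unfolding T_def by auto
  have min: "energy (\<rho> \<tau>) (u \<tau>) \<le> energy (\<rho> \<tau>) w" if "w \<in> controls" for w
  proof -
    have "w \<in> half_class 1 \<or> w \<in> half_class (-1)"
      using that by (auto simp: half_class_def)
    then show ?thesis
    proof
      assume "w \<in> half_class 1"
      then show ?thesis by (rule u(2)[OF \<tau>(1)])
    next
      assume "w \<in> half_class (-1)"
      from v(2)[OF \<tau>(1) this] \<tau>(2) show ?thesis by simp
    qed
  qed
  have uv: "u \<tau> \<in> controls" "v \<tau> \<in> controls" using u(1)[OF \<tau>(1)] v(1)[OF \<tau>(1)] half by blast+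
  \<comment> \<open>Equal values would satisfy both constraints and so be the midpoint. The margin
    then puts the minimum at least k/4 - d above the average of \<open>P a\<close> and
    \<open>P b\<close>, while the two layers put it at most e above that average.\<close>
  have "profile (u \<tau>) (1/2) \<noteq> profile (v \<tau>) (1/2)"
  proof
    assume "profile (u \<tau>) (1/2) = profile (v \<tau>) (1/2)"
    then have "profile (u \<tau>) (1/2) = 1/2 * a + (1 - 1/2) * b"
      using u(1)[OF \<tau>(1)] v(1)[OF \<tau>(1)] by (auto simp: half_class_def field_simps)
    from lower[OF \<tau>(1) uv(1) this, of "k / 4"]
    have "1/2 * P a \<tau> + 1/2 * P b \<tau> + k / 4 - d \<le> energy (\<rho> \<tau>) (u \<tau>)" by simp
    moreover obtain w where "w \<in> half_class 1" "energy (\<rho> \<tau>) w \<le> P b \<tau> + e"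
      using early[OF \<tau>(1)] by blast
    moreover obtain w' where "w' \<in> half_class (-1)" "energy (\<rho> \<tau>) w' \<le> P a \<tau> + e"
      using late[OF \<tau>(1)] by blast
    moreover have "energy (\<rho> \<tau>) (u \<tau>) \<le> energy (\<rho> \<tau>) w" "energy (\<rho> \<tau>) (u \<tau>) \<le> energy (\<rho> \<tau>) w'"
      using calculation half by (auto intro!: min)
    ultimately show False using ed by linarith
  qed
  with that[OF \<rho>[OF \<tau>(1)] uv] min \<tau>(2) show thesis by simp
qed

end

section \<open>Choice of the constants\<close>

theorem theorem2p5:
  fixes \<phi>0 \<phi>1 \<epsilon>0 :: real
  assumes "\<phi>0 < \<phi>1" and "\<epsilon>0 = 1 / (\<phi>1 - \<phi>0)"
  shows "\<exists>\<epsilon>2\<in>{0<..<\<epsilon>0}. \<forall>\<epsilon>\<in>{0<..<\<epsilon>2}. \<exists>\<rho>\<in>densities.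
           G_minimizers \<phi>0 \<phi>1 \<epsilon> \<rho> \<noteq> {} \<and> \<not> is_singleton (G_minimizers \<phi>0 \<phi>1 \<epsilon> \<rho>)"
proof -
  define D where "D = \<phi>1 - \<phi>0"
  have D: "0 < D" using assms by (simp add: D_def)
  define c where "c = balance \<phi>0 \<phi>1"
  \<comment> \<open>Leaves room in [0,1] for the step \<delta> and a further shift by
    \<delta>/2.\<close>
  define \<delta> where "\<delta> = min c (1 - c) / 2"
  have \<delta>: "0 < \<delta>" "2 * \<delta> \<le> c" "2 * \<delta> \<le> 1 - c"
    using balance_bounds[OF assms(1)] by (auto simp: \<delta>_def c_def)
  obtain k0 where k0: "0 < k0"
    "\<And>t. 0 \<le> t \<Longrightarrow> t \<le> 1 \<Longrightarrow> softplus (t * \<phi>0 + (1 - t) * \<phi>1)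
       \<le> t * softplus \<phi>0 + (1 - t) * softplus \<phi>1 - k0 * (t * (1 - t))"
    using softplus_strongly_convex[OF assms(1)] by blast
  \<comment> \<open>Lowering the convexity constant is harmless, and k \<le> \<delta> D is the bound
    \<open>energy_ge\<close> requires for the reduced step \<delta>/2.\<close>
  define k where "k = min k0 (\<delta> * D)"
  have k: "0 < k" "k \<le> \<delta> * D" using k0 \<delta> D by (auto simp: k_def)
  have convex: "softplus (t * \<phi>0 + (1 - t) * \<phi>1)
       \<le> t * softplus \<phi>0 + (1 - t) * softplus \<phi>1 - k * (t * (1 - t))" if "0 \<le> t" "t \<le> 1" for t
  proof -
    have "k * (t * (1 - t)) \<le> k0 * (t * (1 - t))"
      using that by (intro mult_right_mono) (auto simp: k_def)
    with k0(2)[OF that] show ?thesis by linarith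
  qed
  \<comment> \<open>Spends half of the margin k/4 on the part of the entropy bound that does not
    shrink with \<epsilon>.\<close>
  define p where "p = 1 - exp (- k / 8)"
  have p: "0 < p" "p < 1" "ln (1 - p) = - k / 8" using k by (auto simp: p_def)
  \<comment> \<open>The coefficient of \<epsilon> in the sum of the layer cost and the entropy
    error; the second entry of \<open>\<epsilon>2\<close> holds \<epsilon> K below the other half of
    the margin, and the first ensures \<epsilon> D < 1/2.\<close>
  define K where "K = 2 * D * D - D * ln p"
  have "ln p < 0" using p by simp
  then have "D * ln p < 0" using D by (simp add: mult_pos_neg)
  moreover have "0 < 2 * D * D" using D by simp
  ultimately have K: "0 < K" unfolding K_def by linarith
  define \<epsilon>2 where "\<epsilon>2 = min (1 / (2 * D)) (k / (8 * K))"
  have "0 < \<epsilon>2" "\<epsilon>2 < \<epsilon>0"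
    using D K k assms by (auto simp: \<epsilon>2_def D_def[symmetric] min_less_iff_disj field_simps)
  moreover have "\<exists>\<rho>\<in>densities. G_minimizers \<phi>0 \<phi>1 \<epsilon> \<rho> \<noteq> {} \<and> \<not> is_singleton (G_minimizers \<phi>0 \<phi>1 \<epsilon> \<rho>)"
    if \<epsilon>: "\<epsilon> \<in> {0<..<\<epsilon>2}" for \<epsilon>
  proof -
    have "\<epsilon> * D < 1/2" "\<epsilon> * K < k / 8"
      using \<epsilon> D K by (auto simp: \<epsilon>2_def field_simps)
    interpret profile_problem \<phi>0 \<phi>1 \<epsilon>
      using assms(1) \<epsilon> \<open>\<epsilon> * D < 1/2\<close> by unfold_locales (auto simp: D_def)
    have "2 * D * (\<epsilon> * D) - (\<epsilon> * D * ln p + ln (1 - p)) = \<epsilon> * K + k / 8"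
      by (simp add: p(3) K_def algebra_simps)
    then have "2 * D * (\<epsilon> * D) - (\<epsilon> * D * ln p + ln (1 - p)) < k / 4"
      using \<open>\<epsilon> * K < k / 8\<close> by simp
    then obtain \<rho> u v where \<rho>: "\<rho> \<in> unit_weights" and uv: "u \<in> controls" "v \<in> controls"
      and ne: "profile u (1/2) \<noteq> profile v (1/2)"
      and min: "\<And>w. w \<in> controls \<Longrightarrow> energy \<rho> u \<le> energy \<rho> w"
        "\<And>w. w \<in> controls \<Longrightarrow> energy \<rho> v \<le> energy \<rho> w"
      using two_minimizers[of k \<delta> p] k \<delta> p(1,2) convex unfolding c_def D_def by (metis less_imp_le)
    have "restrict (profile u) {0..1} \<in> G_minimizers \<phi>0 \<phi>1 \<epsilon> \<rho>"
      "restrict (profile v) {0..1} \<in> G_minimizers \<phi>0 \<phi>1 \<epsilon> \<rho>"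
      using minimizer_in_G_minimizers uv \<rho> min by blast+
    moreover have "restrict (profile u) {0..1} \<noteq> restrict (profile v) {0..1}"
    proof
      assume "restrict (profile u) {0..1} = restrict (profile v) {0..1}"
      from fun_cong[OF this, of "1/2"] ne show False by simp
    qed
    moreover have "\<rho> \<in> densities" using \<rho> by (auto simp: densities_def unit_weights_def)
    ultimately show ?thesis by (metis empty_iff is_singleton_def singletonD)
  qed
  ultimately show ?thesis by (intro bexI[of _ \<epsilon>2] ballI) auto
qed

end
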